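(* Let $K$ be a field, $n\ge 2$ an integer, and let $a,d\in K$ be such that $R_k(a,d)\neq 0$ for all $k\in\mathbb{N}$. Put $e:=1-d$ and $d_k:=d\sum_{j=0}^{k-1}e^j(-a)^{k-1-j}$ for $k\in\mathbb{N}$ (so that $R_k(a,d)=e^k+d_k$). Define the infinite matrix $\widetilde{M}$ by $$\widetilde{M}_{j,0}=-\widetilde{M}_{j,1}=1\quad\text{for } 0\le j<n,$$ $$\widetilde{M}_{kn+j,0}=-\widetilde{M}_{kn+j,1}=d\prod_{i=2}^{k}\frac{d_i}{d_i+e^i}\quad\text{for } k\ge 1,\ 0\le j<n,$$ $$\widetilde{M}_{kn+j,rn}=-\widetilde{M}_{kn+j,rn+1}=\frac{(-a)^r}{e^r+d_r}\prod_{i=r+1}^{k}\frac{d_i}{d_i+e^i}\quad\text{for } k\ge r\ge 1,\ 0\le j<n,$$ and all other entries of $\widetilde{M}$ equal to zero. Then $\widetilde{M}$ determines a graded twisting map, i.e. $M:=\widetilde{M}+Y$ is the matrix of a graded twisting map $K[y]\otimes K[x]\to K[x]\otimes K[y]$.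
   Context: $\mathbb{N}=\{1,2,\dots\}$, $\mathbb{N}_0=\mathbb{N}\cup\{0\}$; empty products equal $1$ and $0^0=1$. For $k\in\mathbb{N}$, $R_k(a,d):=(1-d)^k+d\sum_{j=0}^{k-1}(1-d)^j(-a)^{k-1-j}$. Tensor products are over $K$; $\mu_{K[x]},\mu_{K[y]}$ denote multiplication. $L(K^{\mathbb{N}_0})$ is the algebra of infinite matrices over $K$ indexed by $\mathbb{N}_0\times\mathbb{N}_0$ with finitely many nonzero entries in each row; $Y$ is the matrix with $Y_{ij}=\delta_{i+1,j}$. A twisting map is a $K$-linear map $\tau:K[y]\otimes K[x]\to K[x]\otimes K[y]$ such that $\tau(1\otimes f)=f\otimes 1$ and $\tau(y^r\otimes 1)=1\otimes y^r$ for all $f\in K[x]$, $r\ge 0$; $\tau\circ(\mathrm{id}_{K[y]}\otimes\mu_{K[x]})=(\mu_{K[x]}\otimes \mathrm{id}_{K[y]})\circ(\mathrm{id}_{K[x]}\otimes\tau)\circ(\tau\otimes \mathrm{id}_{K[x]})$; and $\tau\circ(\mu_{K[y]}\otimes\mathrm{id}_{K[x]})=(\mathrm{id}_{K[x]}\otimes\mu_{K[y]})\circ(\tau\otimes\mathrm{id}_{K[y]})\circ(\mathrm{id}_{K[y]}\otimes\tau)$. It is graded if $\tau(y^r\otimes x^i)$ lies in the span of $\{x^{r+i-j}\otimes y^j:0\le j\le r+i\}$ for all $r,i$. The matrix of a graded twisting map $\tau$ is the matrix $M\in L(K^{\mathbb{N}_0})$ with $\tau(y^k\otimes x)=\sum_{j=0}^{k+1}M_{kj}\,x^{k+1-j}\otimes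 y^j$ and $M_{kj}=0$ for $j>k+1$. A matrix $M\in L(K^{\mathbb{N}_0})$ is the matrix of a (unique) graded twisting map if and only if $M_{0j}=\delta_{0j}$, $M_{kj}=0$ for $j>k+1$, and $Y^kM=\sum_{j=0}^{k+1}M_{kj}M^{k+1-j}Y^j$ for all $k\in\mathbb{N}_0$. *)

theory Defs
  imports "HOL-Library.Poly_Mapping" "HOL-Computational_Algebra.Polynomial"
begin

section \<open>Free vector spaces and their tensor products\<close>

text \<open>
  The space \<open>'x \<Rightarrow>\<^sub>0 'a\<close> of finitely supported functions is the vector space over \<open>'a\<close> with basis
  \<open>Poly_Mapping.single x 1\<close>. The tensor product of the spaces with bases \<open>'x\<close> and \<open>'y\<close> is
  the space with basis \<open>'x \<times> 'y\<close>, and \<open>tensor u v\<close> is the pure tensor of \<open>u\<close> and \<open>v\<close>; the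
  universal property is \<open>tensor_universal\<close> below.

  The polynomial rings \<open>K[x]\<close> and \<open>K[y]\<close> are both \<open>nat \<Rightarrow>\<^sub>0 'a\<close>, the monoid algebra of the natural
  numbers, whose basis element with index \<open>i\<close> is the \<open>i\<close>-th power of the variable; see
  \<open>bij_to_poly\<close> and \<open>to_poly_mult\<close> for the identification with \<open>'a poly\<close>.
\<close>

definition scale :: "'a::comm_ring_1 \<Rightarrow> ('x \<Rightarrow>\<^sub>0 'a) \<Rightarrow> ('x \<Rightarrow>\<^sub>0 'a)" where
  "scale c v = Poly_Mapping.map ((*) c) v"

definition lin_ext ::
    "('x \<Rightarrow> ('y \<Rightarrow>\<^sub>0 'a)) \<Rightarrow> ('x \<Rightarrow>\<^sub>0 'a) \<Rightarrow> ('y \<Rightarrow>\<^sub>0 'a::comm_ring_1)" where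
  "lin_ext b v = (\<Sum>x\<in>Poly_Mapping.keys v. scale (Poly_Mapping.lookup v x) (b x))"

definition tensor ::
    "('x \<Rightarrow>\<^sub>0 'a) \<Rightarrow> ('y \<Rightarrow>\<^sub>0 'a) \<Rightarrow> ('x \<times> 'y \<Rightarrow>\<^sub>0 'a::comm_ring_1)" where
  "tensor u v = (\<Sum>x\<in>Poly_Mapping.keys u. \<Sum>y\<in>Poly_Mapping.keys v.
     Poly_Mapping.single (x, y) (Poly_Mapping.lookup u x * Poly_Mapping.lookup v y))"

text \<open>The tensor product of linear maps, defined by its values on the basis.\<close>

definition tensor_map ::
    "(('x \<Rightarrow>\<^sub>0 'a) \<Rightarrow> ('u \<Rightarrow>\<^sub>0 'a)) \<Rightarrow> (('y \<Rightarrow>\<^sub>0 'a) \<Rightarrow> ('v \<Rightarrow>\<^sub>0 'a))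
      \<Rightarrow> ('x \<times> 'y \<Rightarrow>\<^sub>0 'a) \<Rightarrow> ('u \<times> 'v \<Rightarrow>\<^sub>0 'a::comm_ring_1)" where
  "tensor_map f g =
     lin_ext (\<lambda>(x, y). tensor (f (Poly_Mapping.single x 1)) (g (Poly_Mapping.single y 1)))"

definition assoc_r :: "(('x \<times> 'y) \<times> 'z \<Rightarrow>\<^sub>0 'a) \<Rightarrow> ('x \<times> 'y \<times> 'z \<Rightarrow>\<^sub>0 'a::comm_ring_1)" where
  "assoc_r = lin_ext (\<lambda>((x, y), z). Poly_Mapping.single (x, y, z) 1)"

definition assoc_l :: "('x \<times> 'y \<times> 'z \<Rightarrow>\<^sub>0 'a) \<Rightarrow> (('x \<times> 'y) \<times> 'z \<Rightarrow>\<^sub>0 'a::comm_ring_1)" where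
  "assoc_l = lin_ext (\<lambda>(x, y, z). Poly_Mapping.single ((x, y), z) 1)"

definition mu :: "(nat \<times> nat \<Rightarrow>\<^sub>0 'a) \<Rightarrow> (nat \<Rightarrow>\<^sub>0 'a::comm_ring_1)" where
  "mu = lin_ext (\<lambda>(i, j). Poly_Mapping.single (i + j) 1)"

definition to_poly :: "(nat \<Rightarrow>\<^sub>0 'a::comm_ring_1) \<Rightarrow> 'a poly" where
  "to_poly p = Abs_poly (Poly_Mapping.lookup p)"


subsection \<open>Consistency of these definitions\<close>

lemma lookup_scale [simp]: "Poly_Mapping.lookup (scale c v) x = c * Poly_Mapping.lookup v x"
  unfolding scale_def by transfer (simp add: when_def)

lemma vector_space_scale: "vector_space (scale :: 'a::field \<Rightarrow> ('x \<Rightarrow>\<^sub>0 'a) \<Rightarrow> _)"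
  by unfold_locales (auto intro!: poly_mapping_eqI simp: lookup_add algebra_simps)

lemma lookup_tensor [simp]:
  "Poly_Mapping.lookup (tensor u v) (x, y) = Poly_Mapping.lookup u x * Poly_Mapping.lookup v y"
proof -
  have eq: "Poly_Mapping.lookup (Poly_Mapping.single (x', y') c) (x, y)
      = (if x' = x then if y' = y then c else 0 else 0)" for x' y' and c :: 'a
    by (simp add: lookup_single when_def)
  have inner: "(\<Sum>y'\<in>Poly_Mapping.keys v. if x' = x then if y' = y then
       Poly_Mapping.lookup u x' * Poly_Mapping.lookup v y' else 0 else 0)
     = (if x' = x then Poly_Mapping.lookup u x' * Poly_Mapping.lookup v y else 0)" for x'
    by (auto simp: in_keys_iff)
  show ?thesis
    unfolding tensor_def lookup_sum eq inner by (auto simp: in_keys_iff)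
qed

lemma lin_ext_superset:
  assumes "finite A" "Poly_Mapping.keys v \<subseteq> A"
  shows "lin_ext b v = (\<Sum>x\<in>A. scale (Poly_Mapping.lookup v x) (b x))"
  unfolding lin_ext_def using assms
  by (intro sum.mono_neutral_left) (auto intro!: poly_mapping_eqI simp: in_keys_iff)

lemma linear_lin_ext:
  "Vector_Spaces.linear scale scale (lin_ext (b :: 'x \<Rightarrow> ('y \<Rightarrow>\<^sub>0 'a::field)))"
  unfolding Vector_Spaces.linear_iff
proof (intro conjI allI vector_space_scale)
  interpret vector_space "scale :: 'a \<Rightarrow> ('y \<Rightarrow>\<^sub>0 'a) \<Rightarrow> _" by (rule vector_space_scale)
  fix u v :: "'x \<Rightarrow>\<^sub>0 'a" and c :: 'a
  let ?A = "Poly_Mapping.keys u \<union> Poly_Mapping.keys v"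
  have "Poly_Mapping.keys (u + v) \<subseteq> ?A" by (rule keys_add)
  then show "lin_ext b (u + v) = lin_ext b u + lin_ext b v"
    by (simp add: lin_ext_superset[of ?A] lookup_add scale_left_distrib sum.distrib)
  have "Poly_Mapping.keys (scale c u) \<subseteq> Poly_Mapping.keys u" by (auto simp: in_keys_iff)
  then show "lin_ext b (scale c u) = scale c (lin_ext b u)"
    by (simp add: lin_ext_superset[of "Poly_Mapping.keys u"] scale_sum_right)
qed

lemma lin_ext_single [simp]: "lin_ext b (Poly_Mapping.single x c) = scale c (b x)"
  by (cases "c = 0") (auto intro!: poly_mapping_eqI simp: lin_ext_def)

lemma scale_single [simp]: "scale c (Poly_Mapping.single x b) = Poly_Mapping.single x (c * b)"
  by (rule poly_mapping_eqI) (simp add: lookup_single when_def)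

lemma sum_single_eq:
  "v = (\<Sum>x\<in>Poly_Mapping.keys v. Poly_Mapping.single x (Poly_Mapping.lookup v x))"
  by (rule poly_mapping_eqI)
     (auto simp: lookup_sum lookup_single when_def in_keys_iff)

lemma linear_eq_on_basis:
  fixes s :: "'a::field \<Rightarrow> 'c::ab_group_add \<Rightarrow> 'c" and f g :: "('x \<Rightarrow>\<^sub>0 'a) \<Rightarrow> 'c"
  assumes f: "Vector_Spaces.linear scale s f" and g: "Vector_Spaces.linear scale s g"
    and eq: "\<And>x. f (Poly_Mapping.single x 1) = g (Poly_Mapping.single x 1)"
  shows "f = g"
proof
  fix v :: "'x \<Rightarrow>\<^sub>0 'a"
  interpret F: Vector_Spaces.linear scale s f by (rule f)
  interpret G: Vector_Spaces.linear scale s g by (rule g)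
  have "v = (\<Sum>x\<in>Poly_Mapping.keys v. scale (Poly_Mapping.lookup v x) (Poly_Mapping.single x 1))"
    using sum_single_eq[of v] by simp
  then obtain A c where v: "v = (\<Sum>x\<in>A. scale (c x) (Poly_Mapping.single x 1))" by blast
  show "f v = g v" unfolding v by (simp add: F.sum G.sum F.scale G.scale eq del: scale_single)
qed

lemma tensor_single [simp]:
  "tensor (Poly_Mapping.single x b) (Poly_Mapping.single y c) = Poly_Mapping.single (x, y) (b * c)"
proof (rule poly_mapping_eqI)
  fix p
  show "Poly_Mapping.lookup (tensor (Poly_Mapping.single x b) (Poly_Mapping.single y c)) p
      = Poly_Mapping.lookup (Poly_Mapping.single (x, y) (b * c)) p"
    by (cases p) (simp add: lookup_single when_def)
qed

lemma linear_tensor_left: "Vector_Spaces.linear scale scale (\<lambda>u. tensor u (v :: 'x \<Rightarrow>\<^sub>0 'a::field))"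
  unfolding Vector_Spaces.linear_iff
  by (auto intro!: poly_mapping_eqI vector_space_scale simp: lookup_add algebra_simps)

lemma linear_tensor_right: "Vector_Spaces.linear scale scale (tensor (u :: 'x \<Rightarrow>\<^sub>0 'a::field))"
  unfolding Vector_Spaces.linear_iff
  by (auto intro!: poly_mapping_eqI vector_space_scale simp: lookup_add algebra_simps)

lemma bilinear_eq_on_basis:
  fixes s :: "'a::field \<Rightarrow> 'c::ab_group_add \<Rightarrow> 'c"
    and f g :: "('x \<Rightarrow>\<^sub>0 'a) \<Rightarrow> ('y \<Rightarrow>\<^sub>0 'a) \<Rightarrow> 'c"
  assumes "\<And>u. Vector_Spaces.linear scale s (f u)" "\<And>v. Vector_Spaces.linear scale s (\<lambda>u. f u v)"
    and "\<And>u. Vector_Spaces.linear scale s (g u)" "\<And>v. Vector_Spaces.linear scale s (\<lambda>u. g u v)"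
    and eq: "\<And>x y. f (Poly_Mapping.single x 1) (Poly_Mapping.single y 1)
                  = g (Poly_Mapping.single x 1) (Poly_Mapping.single y 1)"
  shows "f u v = g u v"
proof -
  have "f (Poly_Mapping.single x 1) = g (Poly_Mapping.single x 1)" for x
    by (rule linear_eq_on_basis) (use assms in auto)
  then have "(\<lambda>u. f u v) = (\<lambda>u. g u v)"
    by (intro linear_eq_on_basis) (use assms in auto)
  then show ?thesis by meson
qed

text \<open>The pure tensors satisfy the universal property of the tensor product.\<close>

lemma tensor_universal:
  fixes s :: "'a::field \<Rightarrow> 'c::ab_group_add \<Rightarrow> 'c"
    and \<beta> :: "('x \<Rightarrow>\<^sub>0 'a) \<Rightarrow> ('y \<Rightarrow>\<^sub>0 'a) \<Rightarrow> 'c"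
  assumes right: "\<And>u. Vector_Spaces.linear scale s (\<beta> u)"
    and left: "\<And>v. Vector_Spaces.linear scale s (\<lambda>u. \<beta> u v)"
  shows "\<exists>!L. Vector_Spaces.linear scale s L \<and> (\<forall>u v. L (tensor u v) = \<beta> u v)"
proof (rule ex_ex1I)
  interpret B: Vector_Spaces.linear scale s "\<beta> undefined" by (rule right)
  let ?b = "\<lambda>(x, y). \<beta> (Poly_Mapping.single x 1) (Poly_Mapping.single y 1)"
  define L where "L v = (\<Sum>p\<in>Poly_Mapping.keys v. s (Poly_Mapping.lookup v p) (?b p))" for v
  have L_eq: "L v = (\<Sum>p\<in>A. s (Poly_Mapping.lookup v p) (?b p))"
    if "finite A" "Poly_Mapping.keys v \<subseteq> A" for v A
    unfolding L_def using that by (intro sum.mono_neutral_left) (auto simp: in_keys_iff)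
  have lin: "Vector_Spaces.linear scale s L"
    unfolding Vector_Spaces.linear_iff
  proof (intro conjI allI vector_space_scale B.vs2.vector_space_axioms)
    fix u v :: "'x \<times> 'y \<Rightarrow>\<^sub>0 'a" and c :: 'a
    let ?A = "Poly_Mapping.keys u \<union> Poly_Mapping.keys v"
    have "Poly_Mapping.keys (u + v) \<subseteq> ?A" by (rule keys_add)
    then show "L (u + v) = L u + L v"
      by (simp add: L_eq[of ?A] lookup_add B.vs2.scale_left_distrib sum.distrib)
    have "Poly_Mapping.keys (scale c u) \<subseteq> Poly_Mapping.keys u" by (auto simp: in_keys_iff)
    then show "L (scale c u) = s c (L u)"
      by (simp add: L_eq[of "Poly_Mapping.keys u"] B.vs2.scale_sum_right)
  qed
  have single: "L (Poly_Mapping.single p 1) = ?b p" for p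
    by (simp add: L_def)
  have "L (tensor u v) = \<beta> u v" for u v
  proof (rule bilinear_eq_on_basis[where f = "\<lambda>u v. L (tensor u v)" and g = \<beta>])
    show "Vector_Spaces.linear scale s (\<lambda>v. L (tensor u v))" for u :: "'x \<Rightarrow>\<^sub>0 'a"
      using Vector_Spaces.linear_compose[OF linear_tensor_right lin] by (simp add: o_def)
    show "Vector_Spaces.linear scale s (\<lambda>u. L (tensor u v))" for v :: "'y \<Rightarrow>\<^sub>0 'a"
      using Vector_Spaces.linear_compose[OF linear_tensor_left lin] by (simp add: o_def)
  qed (use right left single in auto)
  with lin show "\<exists>L. Vector_Spaces.linear scale s L \<and> (\<forall>u v. L (tensor u v) = \<beta> u v)" by blast
next
  fix L L' :: "('x \<times> 'y \<Rightarrow>\<^sub>0 'a) \<Rightarrow> 'c"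
  assume L: "Vector_Spaces.linear scale s L \<and> (\<forall>u v. L (tensor u v) = \<beta> u v)"
    and L': "Vector_Spaces.linear scale s L' \<and> (\<forall>u v. L' (tensor u v) = \<beta> u v)"
  have "L (Poly_Mapping.single (x, y) 1) = L' (Poly_Mapping.single (x, y) 1)" for x y
    using L L' tensor_single[of x 1 y "1::'a"] by (metis mult_1)
  then show "L = L'"
    by (intro linear_eq_on_basis) (use L L' in auto)
qed

lemma tensor_map_tensor:
  fixes f :: "('x \<Rightarrow>\<^sub>0 'a::field) \<Rightarrow> ('u \<Rightarrow>\<^sub>0 'a)" and g :: "('y \<Rightarrow>\<^sub>0 'a) \<Rightarrow> ('v \<Rightarrow>\<^sub>0 'a)"
  assumes f: "Vector_Spaces.linear scale scale f" and g: "Vector_Spaces.linear scale scale g"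
  shows "tensor_map f g (tensor u v) = tensor (f u) (g v)"
proof (rule bilinear_eq_on_basis[where f = "\<lambda>u v. tensor_map f g (tensor u v)"
      and g = "\<lambda>u v. tensor (f u) (g v)" and s = scale])
  show "Vector_Spaces.linear scale scale (\<lambda>v. tensor_map f g (tensor u v))" for u
    using Vector_Spaces.linear_compose[OF linear_tensor_right linear_lin_ext]
    by (simp add: o_def tensor_map_def)
  show "Vector_Spaces.linear scale scale (\<lambda>u. tensor_map f g (tensor u v))" for v
    using Vector_Spaces.linear_compose[OF linear_tensor_left linear_lin_ext]
    by (simp add: o_def tensor_map_def)
  show "Vector_Spaces.linear scale scale (\<lambda>v. tensor (f u) (g v))" for u
    using Vector_Spaces.linear_compose[OF g linear_tensor_right] by (simp add: o_def)
  show "Vector_Spaces.linear scale scale (\<lambda>u. tensor (f u) (g v))" for v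
    using Vector_Spaces.linear_compose[OF f linear_tensor_left] by (simp add: o_def)
qed (auto intro!: poly_mapping_eqI simp: tensor_map_def)

lemma assoc_r_tensor:
  fixes u :: "'x \<Rightarrow>\<^sub>0 'a::field" and v :: "'y \<Rightarrow>\<^sub>0 'a" and w :: "'z \<Rightarrow>\<^sub>0 'a"
  shows "assoc_r (tensor (tensor u v) w) = tensor u (tensor v w)"
proof -
  have "Poly_Mapping.lookup (assoc_r t) (x, y, z) = Poly_Mapping.lookup t ((x, y), z)"
    for t :: "('x \<times> 'y) \<times> 'z \<Rightarrow>\<^sub>0 'a" and x y z
  proof -
    have "Poly_Mapping.lookup (assoc_r t) (x, y, z)
        = (\<Sum>p\<in>Poly_Mapping.keys t. if p = ((x, y), z) then Poly_Mapping.lookup t p else 0)"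
      unfolding assoc_r_def lin_ext_def lookup_sum
      by (intro sum.cong) (auto simp: lookup_single when_def split: prod.splits)
    then show ?thesis by (auto simp: in_keys_iff)
  qed
  note lookup_assoc = this
  show ?thesis
  proof (rule poly_mapping_eqI)
    fix p :: "'x \<times> 'y \<times> 'z"
    obtain x y z where "p = (x, y, z)" by (cases p)
    then show "Poly_Mapping.lookup (assoc_r (tensor (tensor u v) w)) p
        = Poly_Mapping.lookup (tensor u (tensor v w)) p"
      by (simp add: lookup_assoc mult.assoc)
  qed
qed

lemma assoc_l_assoc_r: "assoc_l (assoc_r t) = (t :: ('x \<times> 'y) \<times> 'z \<Rightarrow>\<^sub>0 'a::field)"
proof -
  have "assoc_l \<circ> assoc_r = (id :: (('x \<times> 'y) \<times> 'z \<Rightarrow>\<^sub>0 'a) \<Rightarrow> _)"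
  proof (rule linear_eq_on_basis)
    show "Vector_Spaces.linear scale scale (assoc_l \<circ> assoc_r :: (('x \<times> 'y) \<times> 'z \<Rightarrow>\<^sub>0 'a) \<Rightarrow> _)"
      unfolding assoc_l_def assoc_r_def
      by (rule Vector_Spaces.linear_compose[OF linear_lin_ext linear_lin_ext])
    show "Vector_Spaces.linear scale scale (id :: (('x \<times> 'y) \<times> 'z \<Rightarrow>\<^sub>0 'a) \<Rightarrow> _)"
      by (simp add: Vector_Spaces.linear_iff vector_space_scale)
  qed (auto simp: assoc_l_def assoc_r_def split: prod.splits)
  then show ?thesis by (simp add: fun_eq_iff)
qed

lemma assoc_r_assoc_l: "assoc_r (assoc_l t) = (t :: 'x \<times> 'y \<times> 'z \<Rightarrow>\<^sub>0 'a::field)"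
proof -
  have "assoc_r \<circ> assoc_l = (id :: ('x \<times> 'y \<times> 'z \<Rightarrow>\<^sub>0 'a) \<Rightarrow> _)"
  proof (rule linear_eq_on_basis)
    show "Vector_Spaces.linear scale scale (assoc_r \<circ> assoc_l :: ('x \<times> 'y \<times> 'z \<Rightarrow>\<^sub>0 'a) \<Rightarrow> _)"
      unfolding assoc_l_def assoc_r_def
      by (rule Vector_Spaces.linear_compose[OF linear_lin_ext linear_lin_ext])
    show "Vector_Spaces.linear scale scale (id :: ('x \<times> 'y \<times> 'z \<Rightarrow>\<^sub>0 'a) \<Rightarrow> _)"
      by (simp add: Vector_Spaces.linear_iff vector_space_scale)
  qed (auto simp: assoc_l_def assoc_r_def split: prod.splits)
  then show ?thesis by (simp add: fun_eq_iff)
qed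

lemma linear_times_left: "Vector_Spaces.linear scale scale (\<lambda>f. f * (g :: nat \<Rightarrow>\<^sub>0 'a::field))"
  unfolding Vector_Spaces.linear_iff
  by (simp add: vector_space_scale scale_def mult_map_scale_conv_mult algebra_simps)

lemma linear_times_right: "Vector_Spaces.linear scale scale ((*) (f :: nat \<Rightarrow>\<^sub>0 'a::field))"
  unfolding Vector_Spaces.linear_iff
  by (simp add: vector_space_scale scale_def mult_map_scale_conv_mult algebra_simps)

lemma mu_tensor: "mu (tensor f g) = f * (g :: nat \<Rightarrow>\<^sub>0 'a::field)"
proof (rule bilinear_eq_on_basis[where f = "\<lambda>u v. mu (tensor u v)" and g = "(*)" and s = scale])
  show "Vector_Spaces.linear scale scale (\<lambda>v. mu (tensor u v))" for u :: "nat \<Rightarrow>\<^sub>0 'a"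
    using Vector_Spaces.linear_compose[OF linear_tensor_right linear_lin_ext]
    by (simp add: o_def mu_def)
  show "Vector_Spaces.linear scale scale (\<lambda>u. mu (tensor u v))" for v :: "nat \<Rightarrow>\<^sub>0 'a"
    using Vector_Spaces.linear_compose[OF linear_tensor_left linear_lin_ext]
    by (simp add: o_def mu_def)
qed (auto simp: linear_times_left linear_times_right mu_def mult_single)

lemma coeff_to_poly [simp]: "coeff (to_poly p) i = Poly_Mapping.lookup p i"
  unfolding to_poly_def
  by (subst coeff_Abs_poly[where n = "Poly_Mapping.degree p"])
     (auto intro: beyond_degree_lookup_zero)

lemma to_poly_mult: "to_poly (p * q) = to_poly p * to_poly q"
proof (rule poly_eqI)
  fix k
  have inner: "(\<Sum>m. Poly_Mapping.lookup q m when k = l + m)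
      = (if l \<le> k then Poly_Mapping.lookup q (k - l) else 0)" for l
  proof (cases "l \<le> k")
    case True
    then have "(k = l + m) = (m = k - l)" for m by auto
    with True show ?thesis by simp
  qed auto
  have "Poly_Mapping.lookup (p * q) k
      = (\<Sum>l\<le>k. Poly_Mapping.lookup p l * (if l \<le> k then Poly_Mapping.lookup q (k - l) else 0))"
    unfolding lookup_mult inner
    by (rule Sum_any.expand_superset) (auto simp: not_le)
  then show "coeff (to_poly (p * q)) k = coeff (to_poly p * to_poly q) k"
    by (simp add: coeff_mult)
qed

lemma bij_to_poly: "bij (to_poly :: (nat \<Rightarrow>\<^sub>0 'a::comm_ring_1) \<Rightarrow> 'a poly)"
proof (rule bijI)
  show "inj (to_poly :: (nat \<Rightarrow>\<^sub>0 'a) \<Rightarrow> 'a poly)"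
    by (rule injI, rule poly_mapping_eqI) (metis coeff_to_poly)
  have "finite {i. coeff p i \<noteq> 0}" for p :: "'a poly"
    by (rule finite_subset[of _ "{..Polynomial.degree p}"]) (auto intro: le_degree)
  then have "to_poly (Abs_poly_mapping (coeff p)) = p" for p :: "'a poly"
    by (intro poly_eqI) simp
  then show "surj (to_poly :: (nat \<Rightarrow>\<^sub>0 'a) \<Rightarrow> 'a poly)" by (rule surjI[where f = "\<lambda>p. Abs_poly_mapping (coeff p)"])
qed


section \<open>Twisting maps\<close>

text \<open>
  The monomial basis of \<open>K[x]\<close> and of \<open>K[y]\<close>. Since both rings are the same type, the positions in
  a tensor tell them apart: the power \<open>r\<close> of \<open>y\<close> times the power \<open>i\<close> of \<open>x\<close> in \<open>K[y] \<otimes> K[x]\<close> is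
  \<open>tensor (mon r) (mon i)\<close>, and the power \<open>i\<close> of \<open>x\<close> times the power \<open>r\<close> of \<open>y\<close> in
  \<open>K[x] \<otimes> K[y]\<close> is \<open>tensor (mon i) (mon r)\<close>.
\<close>

definition mon :: "nat \<Rightarrow> (nat \<Rightarrow>\<^sub>0 'a::comm_ring_1)" where
  "mon i = Poly_Mapping.single i 1"

definition twisting_map :: "((nat \<times> nat \<Rightarrow>\<^sub>0 'a::field) \<Rightarrow> (nat \<times> nat \<Rightarrow>\<^sub>0 'a)) \<Rightarrow> bool" where
  "twisting_map \<tau> \<longleftrightarrow>
     Vector_Spaces.linear scale scale \<tau> \<and>
     (\<forall>f. \<tau> (tensor 1 f) = tensor f 1) \<and>
     (\<forall>r. \<tau> (tensor (mon r) 1) = tensor 1 (mon r)) \<and>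
     \<tau> \<circ> tensor_map id mu \<circ> assoc_r
       = tensor_map mu id \<circ> assoc_l \<circ> tensor_map id \<tau> \<circ> assoc_r \<circ> tensor_map \<tau> id \<and>
     \<tau> \<circ> tensor_map mu id \<circ> assoc_l
       = tensor_map id mu \<circ> assoc_r \<circ> tensor_map \<tau> id \<circ> assoc_l \<circ> tensor_map id \<tau>"

definition graded_twisting_map ::
    "((nat \<times> nat \<Rightarrow>\<^sub>0 'a::field) \<Rightarrow> (nat \<times> nat \<Rightarrow>\<^sub>0 'a)) \<Rightarrow> bool" where
  "graded_twisting_map \<tau> \<longleftrightarrow>
     twisting_map \<tau> \<and>
     (\<forall>r i. \<tau> (tensor (mon r) (mon i))
        \<in> module.span scale {tensor (mon (r + i - j)) (mon j) | j. j \<le> r + i})"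

text \<open>The index set of the rows and columns consists of all natural numbers, including 0.\<close>

definition row_finite :: "(nat \<Rightarrow> nat \<Rightarrow> 'a::zero) \<Rightarrow> bool" where
  "row_finite M \<longleftrightarrow> (\<forall>i. finite {j. M i j \<noteq> 0})"

definition is_matrix_of ::
    "(nat \<Rightarrow> nat \<Rightarrow> 'a) \<Rightarrow> ((nat \<times> nat \<Rightarrow>\<^sub>0 'a::field) \<Rightarrow> (nat \<times> nat \<Rightarrow>\<^sub>0 'a)) \<Rightarrow> bool" where
  "is_matrix_of M \<tau> \<longleftrightarrow>
     row_finite M \<and>
     (\<forall>k. \<tau> (tensor (mon k) (mon 1)) =
        (\<Sum>j\<le>k + 1. scale (M k j) (tensor (mon (k + 1 - j)) (mon j)))) \<and>
     (\<forall>k j. j > k + 1 \<longrightarrow> M k j = 0)"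

definition Ymat :: "nat \<Rightarrow> nat \<Rightarrow> 'a::zero_neq_one" where
  "Ymat i j = (if i + 1 = j then 1 else 0)"


section \<open>The family of matrices\<close>

definition R :: "nat \<Rightarrow> 'a::field \<Rightarrow> 'a \<Rightarrow> 'a" where
  "R k a d = (1 - d) ^ k + d * (\<Sum>j<k. (1 - d) ^ j * (- a) ^ (k - 1 - j))"

definition dseq :: "'a::field \<Rightarrow> 'a \<Rightarrow> nat \<Rightarrow> 'a" where
  "dseq a d k = d * (\<Sum>j<k. (1 - d) ^ j * (- a) ^ (k - 1 - j))"

text \<open>The entry of the matrix in row \<open>k * n + j\<close> and column \<open>r * n\<close>, for \<open>j < n\<close>.\<close>

definition Mcoef :: "'a::field \<Rightarrow> 'a \<Rightarrow> nat \<Rightarrow> nat \<Rightarrow> 'a" where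
  "Mcoef a d k r =
     (let e = 1 - d; D = dseq a d in
      if r > k then 0
      else if r = 0 then (if k = 0 then 1 else d * (\<Prod>i=2..k. D i / (D i + e ^ i)))
      else (- a) ^ r / (e ^ r + D r) * (\<Prod>i=r+1..k. D i / (D i + e ^ i)))"

text \<open>For \<open>n \<ge> 2\<close> the columns \<open>r * n\<close> and \<open>r * n + 1\<close> are those with residue 0 and 1 modulo \<open>n\<close>.\<close>

definition Mtilde :: "nat \<Rightarrow> 'a::field \<Rightarrow> 'a \<Rightarrow> nat \<Rightarrow> nat \<Rightarrow> 'a" where
  "Mtilde n a d row col =
     (if col mod n = 0 then Mcoef a d (row div n) (col div n)
      else if col mod n = 1 then - Mcoef a d (row div n) (col div n)
      else 0)"

lemma Mtilde_entries:
  fixes a d :: "'a::field"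
  defines "e \<equiv> 1 - d"
  assumes "n \<ge> 2" "j < n"
  shows "Mtilde n a d j 0 = 1" "- Mtilde n a d j 1 = 1"
    and "k \<ge> 1 \<Longrightarrow> Mtilde n a d (k * n + j) 0
           = d * (\<Prod>i=2..k. dseq a d i / (dseq a d i + e ^ i))"
    and "k \<ge> 1 \<Longrightarrow> - Mtilde n a d (k * n + j) 1
           = d * (\<Prod>i=2..k. dseq a d i / (dseq a d i + e ^ i))"
    and "k \<ge> r \<Longrightarrow> r \<ge> 1 \<Longrightarrow> Mtilde n a d (k * n + j) (r * n)
           = (- a) ^ r / (e ^ r + dseq a d r) * (\<Prod>i=r+1..k. dseq a d i / (dseq a d i + e ^ i))"
    and "k \<ge> r \<Longrightarrow> r \<ge> 1 \<Longrightarrow> - Mtilde n a d (k * n + j) (r * n + 1)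
           = (- a) ^ r / (e ^ r + dseq a d r) * (\<Prod>i=r+1..k. dseq a d i / (dseq a d i + e ^ i))"
proof -
  have "Suc (r * n) mod n = Suc 0" "Suc (r * n) div n = r" for r
    using assms(2) mod_mult_self3[of r n 1] div_mult_self3[of n r 1] by auto
  moreover have "n \<noteq> Suc 0" "0 < n" using assms(2) by auto
  ultimately show "Mtilde n a d j 0 = 1" "- Mtilde n a d j 1 = 1"
    and "k \<ge> 1 \<Longrightarrow> Mtilde n a d (k * n + j) 0
           = d * (\<Prod>i=2..k. dseq a d i / (dseq a d i + e ^ i))"
    and "k \<ge> 1 \<Longrightarrow> - Mtilde n a d (k * n + j) 1
           = d * (\<Prod>i=2..k. dseq a d i / (dseq a d i + e ^ i))"
    and "k \<ge> r \<Longrightarrow> r \<ge> 1 \<Longrightarrow> Mtilde n a d (k * n + j) (r * n)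
           = (- a) ^ r / (e ^ r + dseq a d r) * (\<Prod>i=r+1..k. dseq a d i / (dseq a d i + e ^ i))"
    and "k \<ge> r \<Longrightarrow> r \<ge> 1 \<Longrightarrow> - Mtilde n a d (k * n + j) (r * n + 1)
           = (- a) ^ r / (e ^ r + dseq a d r) * (\<Prod>i=r+1..k. dseq a d i / (dseq a d i + e ^ i))"
    using assms(2,3) by (simp_all add: Mtilde_def Mcoef_def Let_def e_def)
qed

lemma Mtilde_eq_0:
  assumes "n \<ge> 2" "j < n" "\<And>r. r \<le> k \<Longrightarrow> c \<noteq> r * n \<and> c \<noteq> r * n + 1"
  shows "Mtilde n a d (k * n + j) c = 0"
proof -
  have "c = (c div n) * n + c mod n" by simp
  with assms(3)[of "c div n"] have "c mod n \<noteq> 0 \<and> c mod n \<noteq> 1 \<or> c div n > k"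
    by (metis add.right_neutral not_le)
  with assms(1,2) show ?thesis by (auto simp: Mtilde_def Mcoef_def)
qed

end

theory Submission
  imports Defs
begin

text \<open>
  Row vectors with finite support are read as polynomials in \<open>y\<close>, so that the rows of a lower
  Hessenberg matrix \<open>M\<close> become the values \<open>m (y^k)\<close> of a linear operator \<open>m\<close> on \<open>K[y]\<close>, and \<open>Y\<close>
  becomes multiplication by \<open>y\<close>. Matrices act on rows from the right, hence products of matrices
  turn into compositions in the opposite order.

  A criterion for \<open>m\<close> to come from a graded twisting map: the only candidate sends \<open>y^r \<otimes> x^i\<close> to the
  homogenization of degree \<open>r + i\<close> of the polynomial \<open>m^i (y^r)\<close>. It always respects products of powers
  of \<open>x\<close>; it respects products of powers of \<open>y\<close> as soon as
  \<open>Y^k M^i = \<Sum>j. (M^i)_{kj} M^{k+i-j} Y^j\<close>, and by induction on \<open>i\<close> the case \<open>i = 1\<close> suffices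
  (\<open>funpow_mon_times\<close>, \<open>graded_twisting_map_twist_of\<close>).

  For the matrix at hand, row \<open>k n + j\<close> of \<open>M - Y\<close> is \<open>(1 - y) c_k (y^n)\<close>, where the polynomial \<open>c_k\<close>
  has the coefficients \<open>Mcoef a d k r\<close>. With \<open>D (y^(k n + j)) = y^k\<close>, \<open>E (y^k) = y^(k n)\<close> and
  \<open>\<gamma> (y^k) = c_k\<close> (\<open>collapse\<close>, \<open>inflate\<close> and \<open>coef_op\<close>) the operator \<open>block_op\<close> is
  \<open>m p = y p + (1 - y) E (\<gamma> (D p))\<close>. All rows in a block agree, so \<open>D\<close>
  annihilates \<open>y^j (1 - y) E g\<close> unless \<open>y^j\<close> pushes it across the end of a block. Therefore
  \<open>D m^j = D y^j\<close> for \<open>j < n\<close> and \<open>D m^n = \<pi> D\<close> with \<open>\<pi> g = y g + (1 - y) \<gamma> g\<close> (\<open>quotient_op\<close>), and the dependence on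
  \<open>n\<close> disappears: the criterion becomes \<open>\<gamma> (y^q g) = \<Sum>r. c_{q,r} y^r \<gamma> (\<pi>^(q-r) g)\<close>
  (\<open>coef_op_mon_times\<close>).

  This identity is about one quadratic algebra. The operator \<open>\<pi>\<close> is the one that \<open>n = 1\<close> would give, and
  it belongs to the algebra generated by \<open>x\<close>, \<open>y\<close> with, for \<open>u = x - y\<close>,
  the relation \<open>(1 - d) y u = d u^2 - a u y\<close>. On rows \<open>x\<close> acts as \<open>\<pi>\<close> and hence \<open>u\<close> as \<open>g \<mapsto> (1 - y) \<gamma> g\<close>;
  in identities whose terms all end in a \<open>u\<close>, up to powers of \<open>y\<close> after it, the last factor \<open>1 - y\<close> is
  common to all terms, and the lemmas state them without it. Induction on \<open>k\<close> turns this relation into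
  \<open>(1 - d)^k y^k u = d_k u y^(k-1) u + (-a)^k u y^k\<close> (\<open>coef_op_power\<close>), and replacing the first \<open>u\<close> on
  the right by \<open>x - y\<close> gives \<open>R_k y^k u = d_k x y^(k-1) u + (-a)^k u y^k\<close>. Division by \<open>R_k\<close>, which is where
  the hypothesis enters, yields a recursion that rewrites \<open>y^k u\<close> with all powers of \<open>x\<close> to the left, and the
  coefficients \<open>Mcoef a d k r\<close> are precisely the solution of this recursion (\<open>coef_row_Suc\<close>).
\<close>

section \<open>Linear maps between free vector spaces\<close>

abbreviation lin :: "(('x \<Rightarrow>\<^sub>0 'a::field) \<Rightarrow> ('y \<Rightarrow>\<^sub>0 'a)) \<Rightarrow> bool" where
  "lin \<equiv> Vector_Spaces.linear scale scale"

lemma lin_iff: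
  "lin f \<longleftrightarrow> (\<forall>u v. f (u + v) = f u + f v) \<and> (\<forall>c u. f (scale c u) = scale c (f u))"
  by (simp add: Vector_Spaces.linear_iff vector_space_scale)

lemma
  assumes "lin f"
  shows lin_add: "f (u + v) = f u + f v"
    and lin_scale: "f (scale c u) = scale c (f u)"
    and lin_diff: "f (u - v) = f u - f v"
    and lin_sum: "f (sum h A) = (\<Sum>x\<in>A. f (h x))"
proof -
  interpret Vector_Spaces.linear scale scale f by (rule assms)
  show "f (u + v) = f u + f v" "f (scale c u) = scale c (f u)" "f (u - v) = f u - f v"
    "f (sum h A) = (\<Sum>x\<in>A. f (h x))"
    by (simp_all add: add scale diff sum)
qed

lemma scale_add_right: "scale c (u + v) = scale c u + scale c (v :: 'x \<Rightarrow>\<^sub>0 'a::field)"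
  and scale_diff_right: "scale c (u - v) = scale c u - scale c (v :: 'x \<Rightarrow>\<^sub>0 'a::field)"
  by (rule poly_mapping_eqI; simp add: lookup_add lookup_minus algebra_simps)+

lemma scale_scale: "scale c (scale b u) = scale (c * b) (u :: 'x \<Rightarrow>\<^sub>0 'a::field)"
  by (rule poly_mapping_eqI) (simp add: algebra_simps)

lemma scale_one: "scale 1 (u :: 'x \<Rightarrow>\<^sub>0 'a::field) = u"
  by (rule poly_mapping_eqI) simp

lemma scale_conv_times: "scale c u = Poly_Mapping.single 0 c * (u :: nat \<Rightarrow>\<^sub>0 'a::field)"
  by (simp add: scale_def mult_map_scale_conv_mult)

lemma lin_id: "lin (\<lambda>v. v)"
  by (simp add: lin_iff)

lemma lin_comp: "lin f \<Longrightarrow> lin g \<Longrightarrow> lin (\<lambda>v. f (g v))"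
  by (simp add: lin_iff)

lemma lin_plus: "lin f \<Longrightarrow> lin g \<Longrightarrow> lin (\<lambda>v. f v + g v)"
  by (simp add: lin_iff scale_add_right algebra_simps)

lemma lin_minus: "lin f \<Longrightarrow> lin g \<Longrightarrow> lin (\<lambda>v. f v - g v)"
  by (simp add: lin_iff scale_diff_right algebra_simps)

lemma lin_scaled: "lin f \<Longrightarrow> lin (\<lambda>v. scale c (f v))"
  by (simp add: lin_iff scale_add_right scale_scale mult.commute)

lemma lin_times:
  fixes f :: "('x \<Rightarrow>\<^sub>0 'a::field) \<Rightarrow> (nat \<Rightarrow>\<^sub>0 'a)"
  shows "lin f \<Longrightarrow> lin (\<lambda>v. q * f v)"
  by (simp add: lin_iff scale_conv_times algebra_simps)

lemma lin_funpow:
  fixes f :: "('x \<Rightarrow>\<^sub>0 'a::field) \<Rightarrow> ('x \<Rightarrow>\<^sub>0 'a)"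
  shows "lin f \<Longrightarrow> lin (f ^^ i)"
  by (induction i) (simp_all add: lin_iff)

lemma lin_tensor_map: "lin (tensor_map f g)"
  and lin_assoc_r: "lin assoc_r"
  and lin_assoc_l: "lin assoc_l"
  unfolding tensor_map_def assoc_r_def assoc_l_def by (rule linear_lin_ext)+

text \<open>
  Identities between linear expressions are reduced to basis vectors by this lemma. The
  restriction to the support matters: homogenizing to degree \<open>N\<close> is only meaningful on polynomials of
  degree at most \<open>N\<close>.
\<close>

lemma lin_eq_on_keys:
  assumes f: "lin f" and g: "lin g" and sub: "Poly_Mapping.keys v \<subseteq> A"
    and eq: "\<And>x. x \<in> A \<Longrightarrow> f (Poly_Mapping.single x 1) = g (Poly_Mapping.single x 1)"
  shows "f v = g v"
proof -
  have v: "v = (\<Sum>x\<in>Poly_Mapping.keys v.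
      scale (Poly_Mapping.lookup v x) (Poly_Mapping.single x 1))"
    using sum_single_eq[of v] by simp
  have "f v = (\<Sum>x\<in>Poly_Mapping.keys v. scale (Poly_Mapping.lookup v x) (f (Poly_Mapping.single x 1)))"
    by (subst v) (simp only: lin_sum[OF f] lin_scale[OF f])
  also have "\<dots> = (\<Sum>x\<in>Poly_Mapping.keys v. scale (Poly_Mapping.lookup v x) (g (Poly_Mapping.single x 1)))"
    using eq sub by (intro sum.cong) auto
  also have "\<dots> = g v"
    by (subst (3) v) (simp only: lin_sum[OF g] lin_scale[OF g])
  finally show ?thesis .
qed

lemma lin_eq_on_mon:
  fixes f g :: "(nat \<Rightarrow>\<^sub>0 'a::field) \<Rightarrow> ('y \<Rightarrow>\<^sub>0 'a)"
  assumes "lin f" "lin g" "\<And>k. f (mon k) = g (mon k)"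
  shows "f v = g v"
  by (rule lin_eq_on_keys[OF assms(1,2), of v UNIV]) (use assms(3) in \<open>simp_all add: mon_def\<close>)

lemma lin_ext_mon: "lin_ext b (mon k) = (b k :: 'y \<Rightarrow>\<^sub>0 'a::field)"
  by (simp add: mon_def scale_one)

lemma lookup_lin_ext_mon:
  fixes f :: "nat \<Rightarrow>\<^sub>0 'a::field"
  assumes "inj h"
  shows "Poly_Mapping.lookup (lin_ext (\<lambda>k. mon (h k)) f) (h k) = Poly_Mapping.lookup f k"
    and "l \<notin> range h \<Longrightarrow> Poly_Mapping.lookup (lin_ext (\<lambda>k. mon (h k)) f) l = 0"
proof -
  have eq: "Poly_Mapping.lookup (lin_ext (\<lambda>k. mon (h k)) f) l
      = (\<Sum>x\<in>Poly_Mapping.keys f. if h x = l then Poly_Mapping.lookup f x else 0)" for l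
    unfolding lin_ext_def lookup_sum by (intro sum.cong) (auto simp: mon_def lookup_single)
  show "Poly_Mapping.lookup (lin_ext (\<lambda>k. mon (h k)) f) (h k) = Poly_Mapping.lookup f k"
    using assms by (simp add: eq inj_eq in_keys_iff)
  show "Poly_Mapping.lookup (lin_ext (\<lambda>k. mon (h k)) f) l = 0" if "l \<notin> range h"
    using that by (auto simp: eq intro!: sum.neutral)
qed

lemma tensor_mon: "tensor (mon i) (mon j) = Poly_Mapping.single (i, j) (1::'a::field)"
  by (simp add: mon_def)

lemma mon_0: "mon 0 = 1"
  by (simp add: mon_def)

lemma mon_mult: "mon i * mon j = (mon (i + j) :: nat \<Rightarrow>\<^sub>0 'a::field)"
  by (simp add: mon_def mult_single)

lemma lookup_mon: "Poly_Mapping.lookup (mon i) j = (if i = j then 1 else 0)"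
  by (simp add: mon_def lookup_single when_def)

lemma mon_mult_assoc: "mon i * (mon j * p) = (mon (i + j) * p :: nat \<Rightarrow>\<^sub>0 'a::field)"
  by (simp add: mult.assoc[symmetric] mon_mult)


section \<open>Twisting maps from operators on the row space\<close>

definition homogenize :: "nat \<Rightarrow> (nat \<Rightarrow>\<^sub>0 'a) \<Rightarrow> (nat \<times> nat \<Rightarrow>\<^sub>0 'a::field)" where
  "homogenize N = lin_ext (\<lambda>j. Poly_Mapping.single (N - j, j) 1)"

text \<open>
  The matrix \<open>\<Sum>j. f_j M^(N-j) Y^j\<close> applied to the row \<open>p\<close>: the homogenization of \<open>f\<close> acts with \<open>x\<close> as \<open>m\<close>
  and \<open>y\<close> as multiplication by \<open>y\<close>, the leftmost factor first.
\<close>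

definition hom_act ::
    "((nat \<Rightarrow>\<^sub>0 'a) \<Rightarrow> (nat \<Rightarrow>\<^sub>0 'a)) \<Rightarrow> nat \<Rightarrow> (nat \<Rightarrow>\<^sub>0 'a) \<Rightarrow> (nat \<Rightarrow>\<^sub>0 'a) \<Rightarrow> (nat \<Rightarrow>\<^sub>0 'a::field)" where
  "hom_act m N f p = lin_ext (\<lambda>j. mon j * (m ^^ (N - j)) p) f"

text \<open>
  Only the condition \<open>\<tau> (y^k \<otimes> x) = homogenize (k + 1) (m (y^k))\<close> is prescribed; compatibility with the
  multiplication of \<open>K[x]\<close> then forces the values on \<open>y^r \<otimes> x^i\<close>.
\<close>

definition twist_of ::
    "((nat \<Rightarrow>\<^sub>0 'a) \<Rightarrow> (nat \<Rightarrow>\<^sub>0 'a)) \<Rightarrow> (nat \<times> nat \<Rightarrow>\<^sub>0 'a) \<Rightarrow> (nat \<times> nat \<Rightarrow>\<^sub>0 'a::field)" where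
  "twist_of m = lin_ext (\<lambda>(r, i). homogenize (r + i) ((m ^^ i) (mon r)))"

lemma lin_homogenize: "lin (homogenize N)"
  and lin_twist_of: "lin (twist_of m)"
  unfolding homogenize_def twist_of_def by (rule linear_lin_ext)+

lemma lin_hom_act: "lin (\<lambda>f. hom_act m N f p)"
  unfolding hom_act_def by (rule linear_lin_ext)

lemma homogenize_single: "homogenize N (Poly_Mapping.single j 1) = Poly_Mapping.single (N - j, j) 1"
  by (simp add: homogenize_def)

lemma homogenize_mon: "homogenize N (mon j) = Poly_Mapping.single (N - j, j) 1"
  by (simp add: mon_def homogenize_single)

lemma twist_of_single:
  "twist_of m (Poly_Mapping.single (r, i) 1) = homogenize (r + i) ((m ^^ i) (mon r))"
  by (simp add: twist_of_def scale_one)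

lemma hom_act_mon: "hom_act m N (mon j) p = mon j * (m ^^ (N - j)) p"
  by (simp add: hom_act_def lin_ext_mon)

lemma tensor_map_single:
  "tensor_map f g (Poly_Mapping.single (x, y) 1)
     = tensor (f (Poly_Mapping.single x 1)) (g (Poly_Mapping.single y (1::'a::field)))"
  by (simp add: tensor_map_def scale_one)

text \<open>
  The two sides of a tensor product of three factors in the axioms of a twisting map are compared
  through these two lemmas: multiplying by a power of \<open>x\<close> on the left only raises the degree of
  homogenization, and multiplying by a power of \<open>y\<close> on the right also multiplies the polynomial.
\<close>

lemma shift_x_homogenize:
  fixes g :: "nat \<Rightarrow>\<^sub>0 'a::field"
  assumes "Poly_Mapping.keys g \<subseteq> {..N}"
  shows "tensor_map mu id (assoc_l (tensor (Poly_Mapping.single p 1) (homogenize N g)))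
           = homogenize (p + N) g"
proof (rule lin_eq_on_keys[OF _ _ assms])
  show "lin (\<lambda>g :: nat \<Rightarrow>\<^sub>0 'a. tensor_map mu id (assoc_l (tensor (Poly_Mapping.single p 1) (homogenize N g))))"
    by (intro lin_comp[OF lin_tensor_map] lin_comp[OF lin_assoc_l] lin_comp[OF linear_tensor_right]
        lin_homogenize)
qed (auto simp: lin_homogenize homogenize_single assoc_l_def tensor_map_single mu_def)

lemma shift_y_homogenize:
  fixes g :: "nat \<Rightarrow>\<^sub>0 'a::field"
  shows "tensor_map id mu (assoc_r (tensor (homogenize N g) (Poly_Mapping.single j 1)))
           = homogenize (N + j) (mon j * g)"
proof (rule lin_eq_on_mon[of _ _ g])
  show "lin (\<lambda>g :: nat \<Rightarrow>\<^sub>0 'a. tensor_map id mu (assoc_r (tensor (homogenize N g) (Poly_Mapping.single j 1))))"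
    by (intro lin_comp[OF lin_tensor_map] lin_comp[OF lin_assoc_r] lin_comp[OF linear_tensor_left]
        lin_homogenize)
  show "lin (\<lambda>g :: nat \<Rightarrow>\<^sub>0 'a. homogenize (N + j) (mon j * g))"
    by (intro lin_comp[OF lin_homogenize] lin_times lin_id)
qed (simp add: homogenize_mon mon_mult assoc_r_def tensor_map_single mu_def add.commute)

text \<open>
  The last axiom is the matrix identity \<open>Y^k M = \<Sum>j. M_{kj} M^(k+1-j) Y^j\<close>, applied to a row \<open>p\<close>.
\<close>

locale twisting_operator =
  fixes m :: "(nat \<Rightarrow>\<^sub>0 'a::field) \<Rightarrow> (nat \<Rightarrow>\<^sub>0 'a)"
  assumes lin_m: "lin m"
    and m_one: "m 1 = 1"
    and keys_m_mon: "Poly_Mapping.keys (m (mon k)) \<subseteq> {..Suc k}"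
    and m_mon_times: "m (mon k * p) = hom_act m (Suc k) (m (mon k)) p"
begin

lemma keys_m:
  assumes "Poly_Mapping.keys f \<subseteq> {..N}"
  shows "Poly_Mapping.keys (m f) \<subseteq> {..Suc N}"
proof -
  have "m f = (\<Sum>j\<in>Poly_Mapping.keys f. scale (Poly_Mapping.lookup f j) (m (mon j)))"
    using sum_single_eq[of f] lin_sum[OF lin_m] lin_scale[OF lin_m]
    by (metis (no_types, lifting) mon_def mult.right_neutral scale_single sum.cong)
  moreover have "Poly_Mapping.lookup (m (mon j)) i = 0" if "j \<in> Poly_Mapping.keys f" "i > Suc N" for i j
    using keys_m_mon[of j] assms that by (force simp: in_keys_iff)
  ultimately have "Poly_Mapping.lookup (m f) i = 0" if "i > Suc N" for i
    using that by (auto simp: lookup_sum intro!: sum.neutral)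
  then show ?thesis by (force simp: in_keys_iff not_le[symmetric])
qed

lemma keys_funpow: "Poly_Mapping.keys ((m ^^ i) (mon r)) \<subseteq> {..r + i}"
proof (induction i)
  case 0
  then show ?case by (simp add: mon_def)
next
  case (Suc i)
  from keys_m[OF this] show ?case by simp
qed

text \<open>
  This is the induction step from \<open>M^i\<close> to \<open>M^(i+1)\<close>: on \<open>f = y^j\<close> the left-hand side is
  \<open>m (y^j m^(N-j) p)\<close>, to which the last axiom applies with \<open>m^(N-j) p\<close> in place of \<open>p\<close>.
\<close>

lemma m_hom_act:
  assumes "Poly_Mapping.keys f \<subseteq> {..N}"
  shows "m (hom_act m N f p) = hom_act m (Suc N) (m f) p"
proof (rule lin_eq_on_keys[OF _ _ assms])
  show "lin (\<lambda>f. m (hom_act m N f p))" by (intro lin_comp[OF lin_m] lin_hom_act)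
  show "lin (\<lambda>f. hom_act m (Suc N) (m f) p)" by (intro lin_comp[OF lin_hom_act] lin_m)
  fix j assume j: "j \<in> {..N}"
  have "hom_act m (Suc j) f ((m ^^ (N - j)) p) = hom_act m (Suc N) f p"
    if "Poly_Mapping.keys f \<subseteq> {..Suc j}" for f
  proof (rule lin_eq_on_keys[OF lin_hom_act lin_hom_act that])
    fix l assume "l \<in> {..Suc j}"
    with j have "Suc j - l + (N - j) = Suc N - l" by auto
    then have "(m ^^ (Suc j - l)) ((m ^^ (N - j)) p) = (m ^^ (Suc N - l)) p"
      by (metis comp_apply funpow_add)
    then show "hom_act m (Suc j) (Poly_Mapping.single l 1) ((m ^^ (N - j)) p)
        = hom_act m (Suc N) (Poly_Mapping.single l 1) p"
      by (simp add: hom_act_def)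
  qed
  from this[OF keys_m_mon]
  have "m (hom_act m N (mon j) p) = hom_act m (Suc N) (m (mon j)) p"
    by (simp add: hom_act_mon m_mon_times)
  then show "m (hom_act m N (Poly_Mapping.single j 1) p)
      = hom_act m (Suc N) (m (Poly_Mapping.single j 1)) p"
    by (simp add: mon_def)
qed

lemma funpow_mon_times: "(m ^^ i) (mon s * p) = hom_act m (s + i) ((m ^^ i) (mon s)) p"
proof (induction i)
  case 0
  then show ?case by (simp add: hom_act_mon)
next
  case (Suc i)
  then show ?case using m_hom_act[OF keys_funpow] by simp
qed

text \<open>
  On a basis vector both sides are homogenizations of degree \<open>r + i + l\<close>, of \<open>m^(i+l) (y^r)\<close> and of
  \<open>m^l (m^i (y^r))\<close>; the intermediate result \<open>m^i (y^r)\<close> is replaced by a single \<open>y^j\<close> by linearity.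
\<close>

lemma twist_mult_x:
  "twist_of m \<circ> tensor_map id mu \<circ> assoc_r
     = tensor_map mu id \<circ> assoc_l \<circ> tensor_map id (twist_of m) \<circ> assoc_r \<circ> tensor_map (twist_of m) id"
  (is "?L = ?R")
proof (rule linear_eq_on_basis)
  show "lin ?L" unfolding o_def
    by (intro lin_comp[OF lin_twist_of] lin_comp[OF lin_tensor_map] lin_assoc_r)
  show "lin ?R" unfolding o_def
    by (intro lin_comp[OF lin_tensor_map] lin_comp[OF lin_assoc_l] lin_comp[OF lin_assoc_r]
        lin_tensor_map)
  fix t :: "(nat \<times> nat) \<times> nat"
  obtain r i l where t: "t = ((r, i), l)" by (metis surj_pair)
  let ?F = "\<lambda>f. tensor_map mu id (assoc_l (tensor_map id (twist_of m)
    (assoc_r (tensor (homogenize (r + i) f) (Poly_Mapping.single l 1)))))"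
  have "?F ((m ^^ i) (mon r)) = homogenize (r + i + l) ((m ^^ l) ((m ^^ i) (mon r)))"
  proof (rule lin_eq_on_keys[OF _ _ keys_funpow])
    show "lin ?F"
      by (intro lin_comp[OF lin_tensor_map] lin_comp[OF lin_assoc_l] lin_comp[OF lin_assoc_r]
          lin_comp[OF linear_tensor_left] lin_homogenize)
    show "lin (\<lambda>f. homogenize (r + i + l) ((m ^^ l) f))"
      by (intro lin_comp[OF lin_homogenize] lin_funpow lin_m)
    fix j assume j: "j \<in> {..r + i}"
    then have "r + i - j + (j + l) = r + i + l" by simp
    then show "?F (Poly_Mapping.single j 1)
        = homogenize (r + i + l) ((m ^^ l) (Poly_Mapping.single j 1))"
      using shift_x_homogenize[OF keys_funpow, of "r + i - j" j l]
      by (simp add: homogenize_single assoc_r_def tensor_map_single twist_of_single mon_def add.assoc)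
  qed
  then show "?L (Poly_Mapping.single t 1) = ?R (Poly_Mapping.single t 1)"
    by (simp add: t assoc_r_def[THEN fun_cong, of "Poly_Mapping.single ((r, i), l) 1"]
        tensor_map_single twist_of_single mu_def[THEN fun_cong, of "Poly_Mapping.single (i, l) 1"] scale_one)
       (metis add.assoc add.commute comp_apply funpow_add)
qed

text \<open>
  On a basis vector the two sides are the homogenizations of \<open>m^i (y^(r+s))\<close> and of
  \<open>hom_act m (s + i) (m^i (y^s)) (y^r)\<close>, which agree by \<open>funpow_mon_times\<close>.
\<close>

lemma twist_mult_y:
  "twist_of m \<circ> tensor_map mu id \<circ> assoc_l
     = tensor_map id mu \<circ> assoc_r \<circ> tensor_map (twist_of m) id \<circ> assoc_l \<circ> tensor_map id (twist_of m)"
  (is "?L = ?R")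
proof (rule linear_eq_on_basis)
  show "lin ?L" unfolding o_def
    by (intro lin_comp[OF lin_twist_of] lin_comp[OF lin_tensor_map] lin_assoc_l)
  show "lin ?R" unfolding o_def
    by (intro lin_comp[OF lin_tensor_map] lin_comp[OF lin_assoc_l] lin_comp[OF lin_assoc_r]
        lin_tensor_map)
  fix t :: "nat \<times> nat \<times> nat"
  obtain r s i where t: "t = (r, s, i)" by (metis surj_pair)
  let ?F = "\<lambda>f. tensor_map id mu (assoc_r (tensor_map (twist_of m) id
    (assoc_l (tensor (Poly_Mapping.single r 1) (homogenize (s + i) f)))))"
  have "?F ((m ^^ i) (mon s)) = homogenize (r + s + i) (hom_act m (s + i) ((m ^^ i) (mon s)) (mon r))"
  proof (rule lin_eq_on_keys[OF _ _ keys_funpow])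
    show "lin ?F"
      by (intro lin_comp[OF lin_tensor_map] lin_comp[OF lin_assoc_l] lin_comp[OF lin_assoc_r]
          lin_comp[OF linear_tensor_right] lin_homogenize)
    show "lin (\<lambda>f. homogenize (r + s + i) (hom_act m (s + i) f (mon r)))"
      by (intro lin_comp[OF lin_homogenize] lin_hom_act)
    fix j assume j: "j \<in> {..s + i}"
    then have "r + (s + i - j) + j = r + s + i" by simp
    then show "?F (Poly_Mapping.single j 1)
        = homogenize (r + s + i) (hom_act m (s + i) (Poly_Mapping.single j 1) (mon r))"
      using shift_y_homogenize[of "r + (s + i - j)" "(m ^^ (s + i - j)) (mon r)" j]
      by (simp add: homogenize_single assoc_l_def tensor_map_single twist_of_single hom_act_def scale_one add.assoc)
  qed
  also have "\<dots> = homogenize (r + s + i) ((m ^^ i) (mon (r + s)))"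
    using funpow_mon_times[of i s "mon r"] by (simp add: mon_mult add.commute[of s r])
  finally show "?L (Poly_Mapping.single t 1) = ?R (Poly_Mapping.single t 1)"
    by (simp add: t assoc_l_def[THEN fun_cong, of "Poly_Mapping.single (r, s, i) 1"]
        tensor_map_single twist_of_single mu_def[THEN fun_cong, of "Poly_Mapping.single (r, s) 1"] scale_one)
qed

lemma graded_twisting_map_twist_of: "graded_twisting_map (twist_of m)"
  unfolding graded_twisting_map_def twisting_map_def
proof (intro conjI allI twist_mult_x twist_mult_y lin_twist_of)
  have m1: "(m ^^ i) 1 = 1" for i
    by (induction i) (simp_all add: m_one)
  show "twist_of m (tensor 1 f) = tensor f 1" for f
  proof (rule lin_eq_on_mon[of _ _ f])
    show "lin (\<lambda>f. twist_of m (tensor 1 f))"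
      by (intro lin_comp[OF lin_twist_of] linear_tensor_right)
    show "twist_of m (tensor 1 (mon k)) = tensor (mon k) 1" for k
      unfolding mon_0[symmetric] by (simp add: tensor_mon twist_of_single m1[unfolded mon_0[symmetric]] homogenize_mon)
  qed (rule linear_tensor_left)
  show "twist_of m (tensor (mon r) 1) = tensor 1 (mon r)" for r
    unfolding mon_0[symmetric] by (simp add: tensor_mon twist_of_single homogenize_mon)
  fix r i
  interpret vector_space "scale :: 'a \<Rightarrow> (nat \<times> nat \<Rightarrow>\<^sub>0 'a) \<Rightarrow> _" by (rule vector_space_scale)
  have "twist_of m (tensor (mon r) (mon i)) = homogenize (r + i) ((m ^^ i) (mon r))"
    by (simp add: mon_def twist_of_single)
  also have "\<dots> \<in> span {tensor (mon (r + i - j)) (mon j) | j. j \<le> r + i}"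
    unfolding homogenize_def lin_ext_superset[OF finite_atMost keys_funpow]
    by (intro span_sum span_scale span_base) (auto simp: mon_def)
  finally show "twist_of m (tensor (mon r) (mon i))
      \<in> span {tensor (mon (r + i - j)) (mon j) | j. j \<le> r + i}" .
qed

lemma is_matrix_of_twist_of: "is_matrix_of (\<lambda>i j. Poly_Mapping.lookup (m (mon i)) j) (twist_of m)"
  unfolding is_matrix_of_def row_finite_def
proof (intro conjI allI impI)
  show "finite {j. Poly_Mapping.lookup (m (mon i)) j \<noteq> 0}" for i by simp
  show "Poly_Mapping.lookup (m (mon k)) j = 0" if "k + 1 < j" for k j
    using keys_m_mon[of k] that by (force simp: in_keys_iff)
  show "twist_of m (tensor (mon k) (mon 1))
      = (\<Sum>j\<le>k + 1. scale (Poly_Mapping.lookup (m (mon k)) j) (tensor (mon (k + 1 - j)) (mon j)))" for k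
  proof -
    have "twist_of m (tensor (mon k) (mon 1)) = homogenize (k + 1) (m (mon k))"
      by (simp add: mon_def twist_of_single)
    also have "\<dots> = (\<Sum>j\<le>k + 1. scale (Poly_Mapping.lookup (m (mon k)) j) (tensor (mon (k + 1 - j)) (mon j)))"
      unfolding homogenize_def
      by (subst lin_ext_superset[of "{..k + 1}"]) (use keys_m_mon in \<open>auto simp: mon_def\<close>)
    finally show ?thesis .
  qed
qed

end


section \<open>The coefficient rows and their quadratic relation\<close>

lemma cst_add: "Poly_Mapping.single 0 (b + c) = Poly_Mapping.single (0::nat) b + Poly_Mapping.single 0 (c::'a::field)"
  by (simp add: single_add)

lemma cst_diff: "Poly_Mapping.single 0 (b - c) = Poly_Mapping.single (0::nat) b - Poly_Mapping.single 0 (c::'a::field)"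
  by (simp add: single_diff)

lemma cst_mult: "Poly_Mapping.single 0 (b * c) = Poly_Mapping.single (0::nat) b * Poly_Mapping.single 0 (c::'a::field)"
  by (simp add: mult_single)

lemma scale_cancel:
  fixes u v :: "'x \<Rightarrow>\<^sub>0 'a::field"
  assumes "scale c u = scale c v" "c \<noteq> 0"
  shows "u = v"
  using assms by (metis left_inverse scale_scale scale_one)

text \<open>
  The sequence \<open>d_k\<close> is \<open>d\<close> times the complete homogeneous polynomial of degree \<open>k - 1\<close> in \<open>1 - d\<close> and
  \<open>-a\<close>, which is symmetric; hence it satisfies two first-order recursions. The first one enters the
  relation for the rows \<open>c_k\<close>, the second one its iteration.
\<close>

lemma dseq_Suc: "dseq a d (Suc k) = (1 - d) * dseq a d k + d * (- a) ^ k"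
proof -
  have "dseq a d (Suc k) = d * ((- a) ^ k + (\<Sum>j<k. (1 - d) ^ Suc j * (- a) ^ (k - 1 - j)))"
    unfolding dseq_def sum.lessThan_Suc_shift by simp
  then show ?thesis
    by (simp add: dseq_def sum_distrib_left algebra_simps)
qed

lemma dseq_Suc': "dseq a d (Suc k) = d * (1 - d) ^ k + (- a) * dseq a d k"
proof -
  have "(\<Sum>j<k. (1 - d) ^ j * (- a) ^ (k - j)) = (- a) * (\<Sum>j<k. (1 - d) ^ j * (- a) ^ (k - 1 - j))"
    unfolding sum_distrib_left
  proof (rule sum.cong)
    fix j assume "j \<in> {..<k}"
    then have "k - j = Suc (k - 1 - j)" by auto
    then show "(1 - d) ^ j * (- a) ^ (k - j) = (- a) * ((1 - d) ^ j * (- a) ^ (k - 1 - j))"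
      by simp
  qed simp
  then show ?thesis by (simp add: dseq_def algebra_simps)
qed

lemma R_eq: "R k a d = (1 - d) ^ k + dseq a d k"
  by (simp add: R_def dseq_def)

locale nonvanishing =
  fixes a d :: "'a::field"
  assumes R_nonzero: "k \<ge> 1 \<Longrightarrow> R k a d \<noteq> 0"
begin

definition coef_row :: "nat \<Rightarrow> (nat \<Rightarrow>\<^sub>0 'a)" where
  "coef_row k = (\<Sum>r\<le>k. Poly_Mapping.single r (Mcoef a d k r))"

definition coef_op :: "(nat \<Rightarrow>\<^sub>0 'a) \<Rightarrow> (nat \<Rightarrow>\<^sub>0 'a)" where
  "coef_op = lin_ext coef_row"

text \<open>The operator induced by \<open>m^n\<close> on the quotient that identifies the powers of \<open>y\<close> in each block.\<close>

definition quotient_op :: "(nat \<Rightarrow>\<^sub>0 'a) \<Rightarrow> (nat \<Rightarrow>\<^sub>0 'a)" where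
  "quotient_op g = mon 1 * g + (1 - mon 1) * coef_op g"

lemma lookup_coef_row: "Poly_Mapping.lookup (coef_row k) r = Mcoef a d k r"
  by (simp add: coef_row_def lookup_sum lookup_single when_def Mcoef_def)

lemma keys_coef_row: "Poly_Mapping.keys (coef_row k) \<subseteq> {..k}"
  by (auto simp: in_keys_iff lookup_coef_row Mcoef_def not_less split: if_splits intro: leI)

lemma lin_coef_op: "lin coef_op"
  unfolding coef_op_def by (rule linear_lin_ext)

lemma coef_op_mon: "coef_op (mon k) = coef_row k"
  by (simp add: coef_op_def lin_ext_mon)

lemma coef_row_0: "coef_row 0 = 1"
  by (simp add: coef_row_def Mcoef_def)

lemma coef_row_Suc:
  "scale (R (Suc k) a d) (coef_row (Suc k))
     = scale (dseq a d (Suc k)) (coef_row k) + scale ((- a) ^ Suc k) (mon (Suc k))"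
proof (rule poly_mapping_eqI)
  fix r
  have nz: "dseq a d (Suc k) + (1 - d) ^ Suc k \<noteq> 0"
    using R_nonzero[of "Suc k"] by (simp add: R_eq add.commute)
  have "R (Suc k) a d * Mcoef a d (Suc k) r
      = dseq a d (Suc k) * Mcoef a d k r + (if r = Suc k then (- a) ^ Suc k else 0)"
  proof -
    consider "r > Suc k" | "r = Suc k" | "r \<le> k" "r \<noteq> 0" | "r = 0" "k = 0" | "r = 0" "k \<noteq> 0"
      by linarith
    then show ?thesis
    proof cases
      case 3
      then have "{r + 1..Suc k} = insert (Suc k) {r + 1..k}" by auto
      with 3 have "Mcoef a d (Suc k) r = dseq a d (Suc k) / (dseq a d (Suc k) + (1 - d) ^ Suc k) * Mcoef a d k r"
        by (simp add: Mcoef_def Let_def mult.left_commute mult.commute del: power_Suc)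
      then show ?thesis using nz 3
        by (simp add: R_eq add.commute[of "(1 - d) ^ Suc k"] del: power_Suc)
    next
      case 4
      then show ?thesis by (simp add: Mcoef_def R_eq dseq_def)
    next
      case 5
      then have "{2..Suc k} = insert (Suc k) {2..k}" by auto
      with 5 have "Mcoef a d (Suc k) r = dseq a d (Suc k) / (dseq a d (Suc k) + (1 - d) ^ Suc k) * Mcoef a d k r"
        by (simp add: Mcoef_def Let_def mult.left_commute mult.commute del: power_Suc)
      then show ?thesis using nz 5
        by (simp add: R_eq add.commute[of "(1 - d) ^ Suc k"] del: power_Suc)
    qed (use nz in \<open>simp_all add: Mcoef_def Let_def R_eq add.commute\<close>)
  qed
  then show "Poly_Mapping.lookup (scale (R (Suc k) a d) (coef_row (Suc k))) r
    = Poly_Mapping.lookup (scale (dseq a d (Suc k)) (coef_row k) + scale ((- a) ^ Suc k) (mon (Suc k))) r"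
    by (simp add: lookup_add lookup_coef_row lookup_mon eq_commute)
qed

text \<open>
  The relation \<open>(1 - d) y u = d u^2 - a u y\<close> on the row \<open>y^k\<close>. Applying
  \<open>g \<mapsto> \<gamma> ((1 - y) g)\<close> to the recursion for \<open>c_k\<close> expresses \<open>R_k\<close> times the right-hand side by the relation
  for \<open>k - 1\<close> and by \<open>c_k - c_{k+1}\<close>; what results is the recursion for \<open>c_{k+1}\<close> because
  \<open>R_{k+1} = (1 - d) R_k + d (-a)^k\<close>. Cancelling \<open>R_k \<noteq> 0\<close> completes the step.
\<close>

lemma coef_row_quadratic:
  "scale (1 - d) (coef_row (Suc k))
     = scale d (coef_op ((1 - mon 1) * coef_row k)) - scale a (mon 1 * coef_row k)"
proof (induction k)
  case 0
  have "coef_op (mon 0 - mon (Suc 0)) = coef_row 0 - coef_row (Suc 0)"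
    by (simp only: lin_diff[OF lin_coef_op] coef_op_mon)
  then have "coef_op (1 - mon 1) = 1 - coef_row (Suc 0)"
    by (simp add: mon_0 coef_row_0)
  moreover have "coef_row (Suc 0) = scale d 1 - scale a (mon 1)"
    using coef_row_Suc[of 0] by (simp add: R_def dseq_def coef_row_0 scale_one scale_conv_times single_uminus)
  moreover have "(1 - x) * (x - y) = x * (1 - (x - y)) - y" for x y :: "nat \<Rightarrow>\<^sub>0 'a"
    by (simp add: algebra_simps)
  ultimately show ?case
    by (simp only: coef_row_0 scale_conv_times cst_diff mult_1_right single_one)
next
  case (Suc k)
  let ?s = "\<lambda>c :: 'a. Poly_Mapping.single (0::nat) c"
  let ?G = "\<lambda>k. coef_op ((1 - mon 1) * coef_row k)"
  let ?k = "Suc k"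
  have rec: "?s (R ?k a d) * coef_row ?k = ?s (dseq a d ?k) * coef_row k + ?s ((- a) ^ ?k) * mon ?k"
    using coef_row_Suc[of k] by (simp only: scale_conv_times)
  have rec': "?s (R (Suc ?k) a d) * coef_row (Suc ?k)
      = ?s (dseq a d (Suc ?k)) * coef_row ?k + ?s ((- a) ^ Suc ?k) * mon (Suc ?k)"
    using coef_row_Suc[of ?k] by (simp only: scale_conv_times)
  have "scale (R ?k a d) ((1 - mon 1) * coef_row ?k) = (1 - mon 1) * scale (R ?k a d) (coef_row ?k)"
    by (simp only: scale_conv_times mult.left_commute)
  also have "\<dots> = scale (dseq a d ?k) ((1 - mon 1) * coef_row k)
      + scale ((- a) ^ ?k) ((1 - mon 1) * mon ?k)"
    unfolding coef_row_Suc by (simp only: scale_conv_times distrib_left mult.left_commute)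
  also have "(1 - mon 1) * mon ?k = (mon ?k - mon (Suc ?k) :: nat \<Rightarrow>\<^sub>0 'a)"
    by (simp add: left_diff_distrib mon_mult)
  finally have "coef_op (scale (R ?k a d) ((1 - mon 1) * coef_row ?k))
      = coef_op (scale (dseq a d ?k) ((1 - mon 1) * coef_row k) + scale ((- a) ^ ?k) (mon ?k - mon (Suc ?k)))"
    by (rule arg_cong)
  then have G: "?s (R ?k a d) * ?G ?k
      = ?s (dseq a d ?k) * ?G k + ?s ((- a) ^ ?k) * (coef_row ?k - coef_row (Suc ?k))"
    by (simp only: lin_scale[OF lin_coef_op] lin_add[OF lin_coef_op] lin_diff[OF lin_coef_op] coef_op_mon)
       (simp only: scale_conv_times)
  have D: "?s (dseq a d (Suc ?k)) = ?s (1 - d) * ?s (dseq a d ?k) + ?s d * ?s ((- a) ^ ?k)"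
    by (simp only: dseq_Suc[of a d ?k] cst_add cst_mult)
  have "R (Suc ?k) a d = (1 - d) * R ?k a d + d * (- a) ^ ?k"
    by (simp only: R_eq dseq_Suc[of a d ?k]) (simp add: algebra_simps)
  then have R: "?s (R (Suc ?k) a d) = ?s (1 - d) * ?s (R ?k a d) + ?s d * ?s ((- a) ^ ?k)"
    by (simp only: cst_add cst_mult)
  have A: "?s ((- a) ^ Suc ?k) = - ?s a * ?s ((- a) ^ ?k)"
    by (simp add: mult_single single_uminus)
  have Y: "mon (Suc ?k) = mon 1 * (mon ?k :: nat \<Rightarrow>\<^sub>0 'a)" by (simp add: mon_mult)
  have IH: "?s (1 - d) * coef_row ?k = ?s d * ?G k - ?s a * (mon 1 * coef_row k)"
    using Suc by (simp only: scale_conv_times)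
  have "?s (R ?k a d) * (?s d * ?G ?k - ?s a * (mon 1 * coef_row ?k))
      = ?s d * (?s (R ?k a d) * ?G ?k) - ?s a * (mon 1 * (?s (R ?k a d) * coef_row ?k))"
    by (simp only: right_diff_distrib mult.left_commute)
  also have "\<dots> = ?s (dseq a d ?k) * (?s d * ?G k - ?s a * (mon 1 * coef_row k))
      + ?s d * ?s ((- a) ^ ?k) * (coef_row ?k - coef_row (Suc ?k))
      + (- ?s a * ?s ((- a) ^ ?k)) * (mon 1 * mon ?k)"
    unfolding G rec by (simp add: algebra_simps)
  also have "\<dots> = (?s (dseq a d (Suc ?k)) * coef_row ?k + ?s ((- a) ^ Suc ?k) * mon (Suc ?k))
      - ?s d * ?s ((- a) ^ ?k) * coef_row (Suc ?k)"
    unfolding IH[symmetric] D A Y by (simp add: algebra_simps)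
  also have "\<dots> = ?s (R ?k a d) * (?s (1 - d) * coef_row (Suc ?k))"
    unfolding rec'[symmetric] R by (simp add: algebra_simps)
  finally have "?s (R ?k a d) * (?s (1 - d) * coef_row (Suc ?k))
      = ?s (R ?k a d) * (?s d * ?G ?k - ?s a * (mon 1 * coef_row ?k))"
    by (rule sym)
  then have "scale (R ?k a d) (scale (1 - d) (coef_row (Suc ?k)))
      = scale (R ?k a d) (scale d (?G ?k) - scale a (mon 1 * coef_row ?k))"
    by (simp only: scale_conv_times)
  then show ?case by (rule scale_cancel) (rule R_nonzero, simp)
qed

lemma coef_op_quadratic:
  "scale (1 - d) (coef_op (mon 1 * g))
     = scale d (coef_op ((1 - mon 1) * coef_op g)) - scale a (mon 1 * coef_op g)"
proof (rule lin_eq_on_mon[of _ _ g])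
  show "lin (\<lambda>g. scale (1 - d) (coef_op (mon 1 * g)))"
    by (intro lin_scaled lin_comp[OF lin_coef_op] lin_times lin_id)
  show "lin (\<lambda>g. scale d (coef_op ((1 - mon 1) * coef_op g)) - scale a (mon 1 * coef_op g))"
    by (intro lin_scaled lin_minus lin_comp[OF lin_coef_op] lin_times lin_coef_op)
qed (simp only: mon_mult coef_op_mon plus_1_eq_Suc coef_row_quadratic)

text \<open>
  The iterated relation \<open>(1 - d)^k y^k u = d_k u y^(k-1) u + (-a)^k u y^k\<close>. For the step, multiply by
  \<open>(1 - d) y\<close> on the left and use the relation \<open>(1 - d) y u = d u^2 - a u y\<close> at both
  occurrences of \<open>y u\<close>; the terms starting with \<open>d u\<close> combine, by the induction hypothesis, to
  \<open>d (1 - d)^k u y^k u\<close>. No division by \<open>1 - d\<close> occurs, so \<open>d = 1\<close> is covered.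
\<close>

lemma coef_op_power:
  "scale ((1 - d) ^ Suc q) (coef_op (mon (Suc q) * g))
     = scale (dseq a d (Suc q)) (coef_op (mon q * ((1 - mon 1) * coef_op g)))
       + scale ((- a) ^ Suc q) (mon (Suc q) * coef_op g)"
proof (induction q arbitrary: g)
  case 0
  then show ?case
    using coef_op_quadratic[of g] by (simp add: mon_0 dseq_def scale_conv_times single_uminus)
next
  case (Suc q)
  let ?s = "\<lambda>c :: 'a. Poly_Mapping.single (0::nat) c"
  let ?h = "(1 - mon 1) * coef_op g"
  let ?L = "\<lambda>v. coef_op (mon q * ((1 - mon 1) * v))"
  have linL: "lin ?L" by (intro lin_comp[OF lin_coef_op] lin_times lin_id)
  have "scale (1 - d) (?L (coef_op (mon 1 * g)))
      = ?L (scale d (coef_op ?h) - scale a (mon 1 * coef_op g))"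
    unfolding coef_op_quadratic[symmetric] lin_scale[OF linL] ..
  also have "\<dots> = scale d (?L (coef_op ?h)) - scale a (coef_op (mon (Suc q) * ?h))"
  proof -
    have "mon (Suc q) = mon q * (mon 1 :: nat \<Rightarrow>\<^sub>0 'a)" by (simp add: mon_mult)
    then have "mon q * ((1 - mon 1) * (mon 1 * v)) = mon (Suc q) * ((1 - mon 1) * v)"
      for v :: "nat \<Rightarrow>\<^sub>0 'a"
      by (simp only: ac_simps)
    then show ?thesis by (simp only: lin_diff[OF linL] lin_scale[OF linL])
  qed
  finally have L: "?s (1 - d) * ?L (coef_op (mon 1 * g))
      = ?s d * ?L (coef_op ?h) - ?s a * coef_op (mon (Suc q) * ?h)"
    by (simp only: scale_conv_times)
  have IHg: "?s ((1 - d) ^ Suc q) * coef_op (mon (Suc (Suc q)) * g)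
      = ?s (dseq a d (Suc q)) * ?L (coef_op (mon 1 * g))
        + ?s ((- a) ^ Suc q) * (mon (Suc q) * coef_op (mon 1 * g))"
    using Suc[of "mon 1 * g"] by (simp add: mon_mult_assoc scale_conv_times del: power_Suc)
  have IHh: "?s ((1 - d) ^ Suc q) * coef_op (mon (Suc q) * ?h)
      = ?s (dseq a d (Suc q)) * ?L (coef_op ?h) + ?s ((- a) ^ Suc q) * (mon (Suc q) * coef_op ?h)"
    using Suc[of ?h] by (simp only: scale_conv_times)
  have Q: "?s (1 - d) * coef_op (mon 1 * g) = ?s d * coef_op ?h - ?s a * (mon 1 * coef_op g)"
    using coef_op_quadratic[of g] by (simp only: scale_conv_times)
  have E: "?s ((1 - d) ^ Suc (Suc q)) = ?s (1 - d) * ?s ((1 - d) ^ Suc q)"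
    by (simp add: mult_single)
  have D: "?s (dseq a d (Suc (Suc q))) = ?s d * ?s ((1 - d) ^ Suc q) + ?s (- a) * ?s (dseq a d (Suc q))"
    by (simp only: dseq_Suc'[of a d "Suc q"] cst_add cst_mult)
  then have D: "?s (dseq a d (Suc (Suc q))) = ?s d * ?s ((1 - d) ^ Suc q) - ?s a * ?s (dseq a d (Suc q))"
    by (simp add: single_uminus)
  have A: "?s ((- a) ^ Suc (Suc q)) = - ?s a * ?s ((- a) ^ Suc q)"
    by (simp add: mult_single single_uminus)
  have Y: "mon (Suc (Suc q)) = mon 1 * (mon (Suc q) :: nat \<Rightarrow>\<^sub>0 'a)" by (simp add: mon_mult)
  have "?s ((1 - d) ^ Suc (Suc q)) * coef_op (mon (Suc (Suc q)) * g)
      = ?s (1 - d) * (?s ((1 - d) ^ Suc q) * coef_op (mon (Suc (Suc q)) * g))"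
    unfolding E by (simp only: mult.assoc)
  also have "\<dots> = ?s (dseq a d (Suc q)) * (?s (1 - d) * ?L (coef_op (mon 1 * g)))
      + ?s ((- a) ^ Suc q) * (mon (Suc q) * (?s (1 - d) * coef_op (mon 1 * g)))"
    unfolding IHg by (simp only: distrib_left mult.left_commute)
  also have "\<dots> = ?s d * (?s (dseq a d (Suc q)) * ?L (coef_op ?h)
        + ?s ((- a) ^ Suc q) * (mon (Suc q) * coef_op ?h))
      - ?s a * ?s (dseq a d (Suc q)) * coef_op (mon (Suc q) * ?h)
      + (- ?s a * ?s ((- a) ^ Suc q)) * ((mon 1 * mon (Suc q)) * coef_op g)"
    unfolding L Q by (simp only: distrib_left right_diff_distrib) (simp only: ac_simps mult_minus_left mult_minus_right diff_conv_add_uminus)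
  also have "\<dots> = ?s (dseq a d (Suc (Suc q))) * coef_op (mon (Suc q) * ?h)
        + ?s ((- a) ^ Suc (Suc q)) * (mon (Suc (Suc q)) * coef_op g)"
    unfolding IHh[symmetric] D A Y by (simp only: left_diff_distrib mult.assoc)
  finally have "?s ((1 - d) ^ Suc (Suc q)) * coef_op (mon (Suc (Suc q)) * g)
      = ?s (dseq a d (Suc (Suc q))) * coef_op (mon (Suc q) * ?h)
        + ?s ((- a) ^ Suc (Suc q)) * (mon (Suc (Suc q)) * coef_op g)" .
  then show ?case by (simp only: scale_conv_times)
qed

text \<open>The relation \<open>R_k y^k u = d_k x y^(k-1) u + (-a)^k u y^k\<close>, where \<open>quotient_op\<close> plays the part of \<open>x\<close>.\<close>

lemma coef_op_mon_Suc_times: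
  "scale (R (Suc q) a d) (coef_op (mon (Suc q) * g))
     = scale (dseq a d (Suc q)) (coef_op (mon q * quotient_op g))
       + scale ((- a) ^ Suc q) (mon (Suc q) * coef_op g)"
proof -
  have "coef_op (mon q * quotient_op g)
      = coef_op (mon (Suc q) * g) + coef_op (mon q * ((1 - mon 1) * coef_op g))"
    by (simp add: quotient_op_def distrib_left mon_mult_assoc lin_add[OF lin_coef_op])
  then show ?thesis
    using coef_op_power[of q g]
    by (simp add: R_eq scale_conv_times cst_add algebra_simps del: power_Suc)
qed

text \<open>
  Both sides satisfy the same recursion in \<open>q\<close>: the left-hand side by the preceding relation, the
  right-hand side because its coefficients are those of \<open>c_q\<close>.
\<close>

lemma coef_op_mon_times:
  "coef_op (mon q * g) = lin_ext (\<lambda>r. mon r * coef_op ((quotient_op ^^ (q - r)) g)) (coef_row q)"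
  (is "_ = lin_ext (?b q g) _")
proof (induction q arbitrary: g)
  case 0
  have "coef_row 0 = mon 0" by (simp add: coef_row_0 mon_0)
  then show ?case by (simp only: lin_ext_mon) (simp add: mon_0)
next
  case (Suc q)
  have lin: "lin (lin_ext (?b (Suc q) g))" by (rule linear_lin_ext)
  have "lin_ext (?b (Suc q) g) (coef_row q) = lin_ext (?b q (quotient_op g)) (coef_row q)"
  proof (rule lin_eq_on_keys[OF linear_lin_ext linear_lin_ext keys_coef_row])
    fix r assume "r \<in> {..q}"
    then show "lin_ext (?b (Suc q) g) (Poly_Mapping.single r 1)
        = lin_ext (?b q (quotient_op g)) (Poly_Mapping.single r 1)"
      by (simp add: Suc_diff_le funpow_swap1)
  qed
  also have "\<dots> = coef_op (mon q * quotient_op g)" by (rule Suc[symmetric])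
  finally have "lin_ext (?b (Suc q) g) (coef_row q) = coef_op (mon q * quotient_op g)" .
  then have "scale (R (Suc q) a d) (lin_ext (?b (Suc q) g) (coef_row (Suc q)))
      = scale (R (Suc q) a d) (coef_op (mon (Suc q) * g))"
    unfolding lin_scale[OF lin, symmetric] coef_row_Suc coef_op_mon_Suc_times
    by (simp add: lin_add[OF lin] lin_scale[OF lin] lin_ext_mon del: power_Suc)
  then show ?case by (rule scale_cancel[symmetric]) (rule R_nonzero, simp)
qed

end

section \<open>Reduction of the block matrix to its quotient\<close>

definition collapse :: "nat \<Rightarrow> (nat \<Rightarrow>\<^sub>0 'a) \<Rightarrow> (nat \<Rightarrow>\<^sub>0 'a::field)" where
  "collapse n = lin_ext (\<lambda>k. mon (k div n))"

definition inflate :: "nat \<Rightarrow> (nat \<Rightarrow>\<^sub>0 'a) \<Rightarrow> (nat \<Rightarrow>\<^sub>0 'a::field)" where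
  "inflate n = lin_ext (\<lambda>k. mon (k * n))"

lemma lin_collapse: "lin (collapse n)"
  and lin_inflate: "lin (inflate n)"
  unfolding collapse_def inflate_def by (rule linear_lin_ext)+

lemma collapse_mon: "collapse n (mon k) = mon (k div n)"
  and inflate_mon: "inflate n (mon k) = mon (k * n)"
  by (simp_all add: collapse_def inflate_def lin_ext_mon)

lemma inflate_mon_times:
  fixes g :: "nat \<Rightarrow>\<^sub>0 'a::field"
  shows "inflate n (mon r * g) = mon (r * n) * inflate n g"
  by (rule lin_eq_on_mon[of _ _ g])
     (auto intro!: lin_comp[OF lin_inflate] lin_times lin_id lin_inflate
       simp: mon_mult inflate_mon add_mult_distrib)

lemma collapse_mon_times:
  fixes p :: "nat \<Rightarrow>\<^sub>0 'a::field"
  assumes "n > 0"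
  shows "collapse n (mon (q * n) * p) = mon q * collapse n p"
  by (rule lin_eq_on_mon[of _ _ p])
     (use assms in \<open>auto intro!: lin_comp[OF lin_collapse] lin_times lin_id lin_collapse
       simp: mon_mult collapse_mon\<close>)

text \<open>
  The difference \<open>y^(k n + j) - y^(k n + j + 1)\<close> lies within one block, and so collapses to zero, except
  when \<open>j = n - 1\<close>.
\<close>

lemma collapse_difference:
  fixes g :: "nat \<Rightarrow>\<^sub>0 'a::field"
  assumes "n > 0"
  shows "Suc j < n \<Longrightarrow> collapse n (mon j * ((1 - mon 1) * inflate n g)) = 0"
    and "collapse n (mon (n - 1) * ((1 - mon 1) * inflate n g)) = (1 - mon 1) * g"
proof -
  have lin: "lin (\<lambda>g :: nat \<Rightarrow>\<^sub>0 'a. collapse n (mon j * ((1 - mon 1) * inflate n g)))" for j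
    by (intro lin_comp[OF lin_collapse] lin_times lin_inflate)
  have eq: "collapse n (mon j * ((1 - mon 1) * inflate n (mon k)))
      = mon ((k * n + j) div n) - (mon ((k * n + Suc j) div n) :: nat \<Rightarrow>\<^sub>0 'a)" for j k
    by (simp add: inflate_mon algebra_simps mon_mult lin_diff[OF lin_collapse] collapse_mon)
  show "collapse n (mon j * ((1 - mon 1) * inflate n g)) = 0" if "Suc j < n"
  proof (rule lin_eq_on_mon[OF lin])
    show "lin (\<lambda>_ :: nat \<Rightarrow>\<^sub>0 'a. 0 :: nat \<Rightarrow>\<^sub>0 'a)" by (simp add: lin_iff scale_conv_times)
    show "collapse n (mon j * ((1 - mon 1) * inflate n (mon k))) = (0 :: nat \<Rightarrow>\<^sub>0 'a)" for k
    proof -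
      have "(k * n + j) div n = k" "(k * n + Suc j) div n = k"
        using \<open>Suc j < n\<close> by (simp_all only: div_mult_self3 div_less Suc_lessD)
      then show ?thesis by (simp only: eq diff_self)
    qed
  qed
  show "collapse n (mon (n - 1) * ((1 - mon 1) * inflate n g)) = (1 - mon 1) * g"
  proof (rule lin_eq_on_mon[OF lin])
    show "lin (\<lambda>g :: nat \<Rightarrow>\<^sub>0 'a. (1 - mon 1) * g)" by (intro lin_times lin_id)
    have "(k * n + (n - 1)) div n = k" "(k * n + Suc (n - 1)) div n = Suc k" for k
    proof -
      have "k * n + Suc (n - 1) = Suc k * n" using assms by simp
      then show "(k * n + Suc (n - 1)) div n = Suc k" using assms by (simp only: div_mult_self_is_m)
      have "n - 1 < n" using assms by simp
      then show "(k * n + (n - 1)) div n = k" by (simp only: div_mult_self3 div_less)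
    qed
    then show "collapse n (mon (n - 1) * ((1 - mon 1) * inflate n (mon k)))
        = (1 - mon 1) * (mon k :: nat \<Rightarrow>\<^sub>0 'a)" for k
      by (simp only: eq) (simp add: left_diff_distrib mon_mult)
  qed
qed

context nonvanishing
begin

definition block_op :: "nat \<Rightarrow> (nat \<Rightarrow>\<^sub>0 'a) \<Rightarrow> (nat \<Rightarrow>\<^sub>0 'a)" where
  "block_op n p = mon 1 * p + (1 - mon 1) * inflate n (coef_op (collapse n p))"

lemma lin_block_op: "lin (block_op n)"
  unfolding block_op_def
  by (intro lin_plus lin_times lin_id lin_comp[OF lin_inflate] lin_comp[OF lin_coef_op] lin_collapse)

lemma block_op_mon: "block_op n (mon k) = mon (Suc k) + (1 - mon 1) * inflate n (coef_row (k div n))"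
  by (simp add: block_op_def mon_mult collapse_mon coef_op_mon)

text \<open>
  Inside a block the correction \<open>(1 - y) E (\<gamma> (D p))\<close> in \<open>block_op\<close> is invisible to \<open>collapse\<close>; it is
  seen exactly once in \<open>n\<close> steps, and there it produces the correction term of \<open>quotient_op\<close>.
\<close>

lemma collapse_block_op_small:
  assumes "i + j < n"
  shows "collapse n (mon i * (block_op n ^^ j) p) = collapse n (mon (i + j) * p)"
  using assms
proof (induction j arbitrary: i)
  case 0
  then show ?case by simp
next
  case (Suc j)
  have "collapse n (mon i * (block_op n ^^ Suc j) p) = collapse n (mon (Suc i) * (block_op n ^^ j) p)"
    using Suc.prems
    by (simp add: block_op_def distrib_left mon_mult_assoc lin_add[OF lin_collapse]
        collapse_difference(1)[simplified])
  also have "\<dots> = collapse n (mon (Suc i + j) * p)"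
    using Suc.prems by (intro Suc.IH) simp
  finally show ?case by simp
qed

lemma collapse_block_op_full:
  assumes "n > 0"
  shows "collapse n ((block_op n ^^ n) p) = quotient_op (collapse n p)"
proof -
  have "(block_op n ^^ n) p = (block_op n ^^ (n - 1)) (block_op n p)"
    using assms by (metis Suc_diff_1 funpow_Suc_right comp_apply)
  then have "collapse n ((block_op n ^^ n) p) = collapse n (mon (n - 1) * block_op n p)"
    using collapse_block_op_small[of 0 "n - 1" n "block_op n p"] assms by (simp add: mon_0)
  \<comment> \<open>The exponent \<open>1 * n\<close> marks one full block, the form in which \<open>collapse\<close> extracts a factor.\<close>
  also have "\<dots> = collapse n (mon (1 * n) * p) + (1 - mon 1) * coef_op (collapse n p)"
    using assms by (simp add: block_op_def distrib_left mon_mult_assoc lin_add[OF lin_collapse]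
        collapse_difference(2)[simplified])
  also have "\<dots> = quotient_op (collapse n p)"
    using assms by (simp only: collapse_mon_times quotient_op_def)
  finally show ?thesis .
qed

lemma collapse_block_op_funpow:
  assumes "j < n"
  shows "collapse n ((block_op n ^^ (s * n + j)) p) = (quotient_op ^^ s) (collapse n (mon j * p))"
proof (induction s)
  case 0
  then show ?case using collapse_block_op_small[of 0 j n p] assms by (simp add: mon_0)
next
  case (Suc s)
  have "(block_op n ^^ (Suc s * n + j)) p = (block_op n ^^ n) ((block_op n ^^ (s * n + j)) p)"
    by (simp add: funpow_add add.assoc)
  then show ?case using assms Suc by (simp add: collapse_block_op_full)
qed

text \<open>
  The criterion for twisting operators. The factor \<open>1 - y\<close> in row \<open>k\<close> contributes
  \<open>y^(r n) (m - y) m^(k - r n) p\<close>, and \<open>m - y\<close> is \<open>(1 - y) E \<gamma> D\<close>. With \<open>D\<close> moved to the right past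
  the powers of \<open>m\<close> the claim is the image under \<open>(1 - y) E\<close> of \<open>coef_op_mon_times\<close>.
\<close>

lemma block_op_mon_times:
  assumes n: "n > 0"
  shows "block_op n (mon k * p) = hom_act (block_op n) (Suc k) (block_op n (mon k)) p"
proof -
  define q j where "q = k div n" and "j = k mod n"
  have k: "k = q * n + j" and j: "j < n" using n by (simp_all add: q_def j_def)
  define g where "g = collapse n (mon j * p)"
  let ?H = "\<lambda>f. hom_act (block_op n) (Suc k) f p"
  let ?b = "\<lambda>r. mon r * coef_op ((quotient_op ^^ (q - r)) g)"
  have "?H ((1 - mon 1) * inflate n (coef_row q)) = (1 - mon 1) * inflate n (lin_ext ?b (coef_row q))"
  proof (rule lin_eq_on_keys[OF _ _ keys_coef_row])
    show "lin (\<lambda>f. ?H ((1 - mon 1) * inflate n f))"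
      by (intro lin_comp[OF lin_hom_act] lin_times lin_inflate)
    show "lin (\<lambda>f. (1 - mon 1) * inflate n (lin_ext ?b f))"
      by (intro lin_times lin_comp[OF lin_inflate] linear_lin_ext)
    fix r assume "r \<in> {..q}"
    then have r: "r * n \<le> k" "k - r * n = (q - r) * n + j"
      by (simp_all add: k diff_mult_distrib trans_le_add1)
    let ?v = "(block_op n ^^ (k - r * n)) p"
    have "?H ((1 - mon 1) * inflate n (mon r)) = ?H (mon (r * n)) - ?H (mon (Suc (r * n)))"
      by (simp add: inflate_mon left_diff_distrib mon_mult lin_diff[OF lin_hom_act])
    also have "\<dots> = mon (r * n) * (block_op n ?v - mon 1 * ?v)"
      using r(1) by (simp add: hom_act_mon Suc_diff_le right_diff_distrib mon_mult_assoc)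
    also have "\<dots> = (1 - mon 1) * (mon (r * n) * inflate n (coef_op (collapse n ?v)))"
      by (simp add: block_op_def mult.left_commute)
    also have "\<dots> = (1 - mon 1) * inflate n (?b r)"
      by (simp add: inflate_mon_times r(2) collapse_block_op_funpow j g_def)
    finally show "?H ((1 - mon 1) * inflate n (Poly_Mapping.single r 1))
        = (1 - mon 1) * inflate n (lin_ext ?b (Poly_Mapping.single r 1))"
      by (simp add: mon_def[symmetric] lin_ext_mon)
  qed
  moreover have "collapse n (mon k * p) = mon q * g"
    using n by (simp add: g_def k collapse_mon_times mon_mult_assoc[symmetric])
  ultimately show ?thesis
    unfolding block_op_mon lin_add[OF lin_hom_act]
    by (simp add: block_op_def[of n "mon k * p"] hom_act_mon mon_mult_assoc coef_op_mon_times q_def)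
qed

lemma lookup_block_op_mon:
  assumes n: "n \<ge> 2"
  shows "Poly_Mapping.lookup (block_op n (mon i)) j = Mtilde n a d i j + Ymat i j"
proof -
  let ?c = "coef_row (i div n)"
  have inflate: "Poly_Mapping.lookup (inflate n f) l
      = (if l mod n = 0 then Poly_Mapping.lookup f (l div n) else 0)" for f :: "nat \<Rightarrow>\<^sub>0 'a" and l
  proof -
    have "inj (\<lambda>k. k * n)" using n by (auto intro: injI)
    note lookup = lookup_lin_ext_mon[OF this, where f = f]
    show ?thesis
    proof (cases "l mod n = 0")
      case True
      then have "l div n * n = l" by auto
      with lookup(1)[of "l div n"] True show ?thesis by (simp only: inflate_def simp_thms if_True)
    next
      case False
      then have "l \<notin> range (\<lambda>k. k * n)" by auto
      with lookup(2) False show ?thesis by (simp add: inflate_def)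
    qed
  qed
  have "mon 1 * f = lin_ext (\<lambda>k. mon (Suc k)) f" for f :: "nat \<Rightarrow>\<^sub>0 'a"
    by (rule lin_eq_on_mon[of _ _ f]) (auto intro!: lin_times lin_id linear_lin_ext simp: mon_mult lin_ext_mon)
  then have shift: "Poly_Mapping.lookup (mon 1 * f) 0 = 0"
      "Poly_Mapping.lookup (mon 1 * f) (Suc l) = Poly_Mapping.lookup f l" for f :: "nat \<Rightarrow>\<^sub>0 'a" and l
    using lookup_lin_ext_mon[of Suc, where f = f] by auto
  have eq: "Poly_Mapping.lookup (block_op n (mon i)) j
      = Ymat i j + Poly_Mapping.lookup (inflate n ?c) j - Poly_Mapping.lookup (mon 1 * inflate n ?c) j"
    by (simp add: block_op_mon left_diff_distrib lookup_add lookup_minus lookup_mon Ymat_def)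
  show ?thesis
  proof (cases j)
    case 0
    then show ?thesis unfolding eq by (simp add: shift[unfolded One_nat_def] inflate lookup_coef_row Mtilde_def)
  next
    case (Suc l)
    consider "Suc l mod n = 0" | "Suc l mod n = Suc (l mod n)"
      by (cases "Suc (l mod n) = n") (simp_all add: mod_Suc)
    then show ?thesis
    proof cases
      case 1
      with n have "l mod n \<noteq> 0" by (auto simp: mod_Suc split: if_splits)
      with 1 show ?thesis unfolding eq by (simp add: Suc shift[unfolded One_nat_def] inflate lookup_coef_row Mtilde_def)
    next
      case 2
      then have "Suc l div n = l div n" by (simp add: div_Suc)
      with 2 show ?thesis unfolding eq by (auto simp: Suc shift[unfolded One_nat_def] inflate lookup_coef_row Mtilde_def)
    qed
  qed
qed

lemma twisting_operator_block_op:
  assumes n: "n \<ge> 2"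
  shows "twisting_operator (block_op n)"
  unfolding twisting_operator_def
proof (intro conjI allI)
  show "lin (block_op n)" by (rule lin_block_op)
  show "block_op n 1 = 1"
    using block_op_mon[of n 0] by (simp add: mon_0 coef_row_0 inflate_mon[of n 0, simplified, unfolded mon_0])
  show "block_op n (mon k * p) = hom_act (block_op n) (Suc k) (block_op n (mon k)) p" for k p
    using n by (intro block_op_mon_times) simp
  show "Poly_Mapping.keys (block_op n (mon k)) \<subseteq> {..Suc k}" for k
  proof
    fix j assume "j \<in> Poly_Mapping.keys (block_op n (mon k))"
    then have nz: "Mtilde n a d k j + Ymat k j \<noteq> 0"
      by (simp add: in_keys_iff lookup_block_op_mon[OF n])
    show "j \<in> {..Suc k}"
    proof (rule ccontr)
      assume "j \<notin> {..Suc k}"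
      with nz have "Mtilde n a d k j \<noteq> 0" by (auto simp: Ymat_def)
      then have "j mod n \<le> 1" "j div n \<le> k div n"
        by (auto simp: Mtilde_def Mcoef_def not_less[symmetric] split: if_splits)
      moreover from this(2) have "j div n * n \<le> k div n * n" by simp
      ultimately have "j \<le> Suc k"
        using div_mult_mod_eq[of j n] div_times_less_eq_dividend[of k n] by linarith
      with \<open>j \<notin> {..Suc k}\<close> show False by simp
    qed
  qed
qed

end

theorem corollary5p6:
  fixes a d :: "'a::field" and n :: nat
  assumes "n \<ge> 2"
    and "\<And>k. k \<ge> 1 \<Longrightarrow> R k a d \<noteq> 0"
  shows "\<exists>\<tau>. graded_twisting_map \<tau> \<and>
             is_matrix_of (\<lambda>i j. Mtilde n a d i j + Ymat i j) \<tau>"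
proof -
  interpret nonvanishing a d by unfold_locales (rule assms(2))
  interpret twisting_operator "block_op n" by (rule twisting_operator_block_op) (rule assms(1))
  show ?thesis
    using graded_twisting_map_twist_of is_matrix_of_twist_of
    unfolding lookup_block_op_mon[OF assms(1)] by blast
qed

end
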